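(* Let $f$ be a strictly convex continuous function on a compact interval $[a,b]$, let $\mathcal{H}$ and $\mathcal{K}$ be Hilbert spaces, let $\varphi\colon B(\mathcal{H})\to B(\mathcal{K})$ be a unital completely positive map, and let $H\in B(\mathcal{H})_{\mathrm{sa}}$ with $\sigma(H)\subset[a,b]$. If $\varphi(f(H))=f(\varphi(H))$, then the restriction of $\varphi$ to the algebra of polynomials in $H$ is multiplicative.
   Context: $B(\mathcal{H})$ is the algebra of bounded linear operators on $\mathcal{H}$ and $B(\mathcal{H})_{\mathrm{sa}}$ its set of self-adjoint elements; $\sigma(\cdot)$ is the spectrum; functions of self-adjoint operators are defined by the continuous functional calculus. The Hilbert spaces may be infinite dimensional. *)

theory Defs
  imports "HOL-Analysis.Analysis"
begin

section \<open>Complex Hilbert spaces\<close>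

class complex_vector = real_vector +
  fixes scaleC :: "complex \<Rightarrow> 'a \<Rightarrow> 'a"  (infixr "*\<^sub>C" 75)
  assumes scaleC_add_right: "c *\<^sub>C (x + y) = c *\<^sub>C x + c *\<^sub>C y"
    and scaleC_add_left: "(c + d) *\<^sub>C x = c *\<^sub>C x + d *\<^sub>C x"
    and scaleC_scaleC: "c *\<^sub>C d *\<^sub>C x = (c * d) *\<^sub>C x"
    and scaleC_of_real: "complex_of_real r *\<^sub>C x = r *\<^sub>R x"

text \<open>The inner product is conjugate-linear in the first argument.\<close>

class complex_inner = complex_vector + real_normed_vector +
  fixes cinner :: "'a \<Rightarrow> 'a \<Rightarrow> complex"
  assumes cinner_commute: "cinner x y = cnj (cinner y x)"
    and cinner_add_right: "cinner x (y + z) = cinner x y + cinner x z"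
    and cinner_scaleC_right: "cinner x (c *\<^sub>C y) = c * cinner x y"
    and cinner_self: "cinner x x = complex_of_real ((norm x)\<^sup>2)"

class chilbert_space = complex_inner + complete_space

instance chilbert_space \<subseteq> banach ..

lemma norm_scaleC: "norm (c *\<^sub>C x) = cmod c * norm (x :: 'a :: complex_inner)"
proof -
  have "cinner (c *\<^sub>C x) (c *\<^sub>C x) = c * cnj (c * cinner x x)"
    by (metis cinner_commute cinner_scaleC_right)
  also have "\<dots> = complex_of_real ((cmod c * norm x)\<^sup>2)"
    by (simp add: cinner_self power_mult_distrib flip: complex_norm_square)
  finally have "(norm (c *\<^sub>C x))\<^sup>2 = (cmod c * norm x)\<^sup>2"
    unfolding cinner_self using of_real_eq_iff by blast
  then show ?thesis
    by (simp add: power2_eq_iff_nonneg)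
qed

lemma bounded_linear_scaleC: "bounded_linear (\<lambda>x :: 'a :: complex_inner. c *\<^sub>C x)"
proof (rule bounded_linear_intro)
  show "c *\<^sub>C r *\<^sub>R x = r *\<^sub>R c *\<^sub>C x" for r and x :: 'a
    by (metis scaleC_scaleC scaleC_of_real mult.commute)
  show "norm (c *\<^sub>C x) \<le> norm x * cmod c" for x :: 'a
    by (simp add: norm_scaleC)
qed (rule scaleC_add_right)


section \<open>Bounded operators\<close>

instantiation blinfun :: (real_normed_vector, complex_inner) complex_vector
begin

lift_definition scaleC_blinfun :: "complex \<Rightarrow> 'a \<Rightarrow>\<^sub>L 'b \<Rightarrow> 'a \<Rightarrow>\<^sub>L 'b" is "\<lambda>c T x. c *\<^sub>C T x"
  by (rule bounded_linear_compose[OF bounded_linear_scaleC])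

instance
  by standard
     (transfer, simp add: scaleC_add_right scaleC_add_left scaleC_scaleC scaleC_of_real)+

end

text \<open>The library's type \<open>'a \<Rightarrow>\<^sub>L 'a\<close> consists of the bounded real-linear maps;
  \<open>bounded_ops\<close> is the algebra $B(\mathcal{H})$ of the complex-linear ones among them.\<close>

definition bounded_ops :: "('a :: complex_inner \<Rightarrow>\<^sub>L 'a) set" where
  "bounded_ops = {T. \<forall>c x. blinfun_apply T (c *\<^sub>C x) = c *\<^sub>C blinfun_apply T x}"

definition selfadjoint_op :: "('a :: complex_inner \<Rightarrow>\<^sub>L 'a) \<Rightarrow> bool" where
  "selfadjoint_op T \<longleftrightarrow>
     T \<in> bounded_ops \<and> (\<forall>x y. cinner (blinfun_apply T x) y = cinner x (blinfun_apply T y))"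

definition op_spectrum :: "('a :: complex_inner \<Rightarrow>\<^sub>L 'a) \<Rightarrow> complex set" where
  "op_spectrum T = {c. \<not> (\<exists>S \<in> bounded_ops.
     S o\<^sub>L (T - c *\<^sub>C id_blinfun) = id_blinfun \<and> (T - c *\<^sub>C id_blinfun) o\<^sub>L S = id_blinfun)}"


section \<open>Functional calculus\<close>

definition poly_op :: "complex poly \<Rightarrow> ('a :: complex_inner \<Rightarrow>\<^sub>L 'a) \<Rightarrow> ('a \<Rightarrow>\<^sub>L 'a)" where
  "poly_op p T = (\<Sum>i\<le>degree p. coeff p i *\<^sub>C (((o\<^sub>L) T ^^ i) id_blinfun))"

definition poly_algebra :: "('a :: complex_inner \<Rightarrow>\<^sub>L 'a) \<Rightarrow> ('a \<Rightarrow>\<^sub>L 'a) set" where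
  "poly_algebra T = range (\<lambda>p. poly_op p T)"

text \<open>Continuous functional calculus of a self-adjoint operator \<open>T\<close>, the continuous extension of
  \<open>p \<mapsto> p(T)\<close> from polynomials to the continuous functions on the spectrum with the supremum norm:
  \<open>f(T)\<close> is the norm limit of \<open>p\<^sub>n(T)\<close> for all polynomials \<open>p\<^sub>n\<close> converging to \<open>f\<close> uniformly
  on the spectrum. As \<open>T\<close> has real spectrum, \<open>f\<close> is taken to be a function of a real variable.
  The value is only meaningful if \<open>T\<close> is self-adjoint and \<open>f\<close> is continuous on the spectrum.\<close>

definition cfc :: "(real \<Rightarrow> complex) \<Rightarrow> ('a :: complex_inner \<Rightarrow>\<^sub>L 'a) \<Rightarrow> ('a \<Rightarrow>\<^sub>L 'a)" where
  "cfc f T = (THE S. \<forall>p :: nat \<Rightarrow> complex poly.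
     uniform_limit {t. complex_of_real t \<in> op_spectrum T}
       (\<lambda>n t. poly (p n) (complex_of_real t)) f sequentially \<longrightarrow>
     (\<lambda>n. poly_op (p n) T) \<longlonglongrightarrow> S)"


section \<open>Unital completely positive maps\<close>

text \<open>Positivity of the matrix $(T_{ij})_{i,j<n} \in M_n(B(\mathcal{H}))$ as an operator on
  $\mathcal{H}^n$; the vectors $(x_j)_{j<n}$ are represented by functions on \<open>nat\<close>.\<close>

definition positive_op_matrix :: "nat \<Rightarrow> (nat \<Rightarrow> nat \<Rightarrow> 'a :: complex_inner \<Rightarrow>\<^sub>L 'a) \<Rightarrow> bool" where
  "positive_op_matrix n T \<longleftrightarrow>
     (\<forall>x :: nat \<Rightarrow> 'a. (\<Sum>i<n. \<Sum>j<n. cinner (x i) (blinfun_apply (T i j) (x j))) \<in> \<real>\<^sub>\<ge>\<^sub>0)"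

definition completely_positive ::
  "(('a :: complex_inner \<Rightarrow>\<^sub>L 'a) \<Rightarrow> ('b :: complex_inner \<Rightarrow>\<^sub>L 'b)) \<Rightarrow> bool" where
  "completely_positive \<phi> \<longleftrightarrow>
     \<phi> ` bounded_ops \<subseteq> bounded_ops \<and>
     (\<forall>S\<in>bounded_ops. \<forall>T\<in>bounded_ops. \<phi> (S + T) = \<phi> S + \<phi> T) \<and>
     (\<forall>c. \<forall>T\<in>bounded_ops. \<phi> (c *\<^sub>C T) = c *\<^sub>C \<phi> T) \<and>
     (\<forall>n. \<forall>T. (\<forall>i<n. \<forall>j<n. T i j \<in> bounded_ops) \<longrightarrow> positive_op_matrix n T \<longrightarrow>
        positive_op_matrix n (\<lambda>i j. \<phi> (T i j)))"

definition unital_map ::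
  "(('a :: complex_inner \<Rightarrow>\<^sub>L 'a) \<Rightarrow> ('b :: complex_inner \<Rightarrow>\<^sub>L 'b)) \<Rightarrow> bool" where
  "unital_map \<phi> \<longleftrightarrow> \<phi> id_blinfun = id_blinfun"

definition multiplicative_on ::
  "('a :: complex_inner \<Rightarrow>\<^sub>L 'a) set \<Rightarrow> (('a \<Rightarrow>\<^sub>L 'a) \<Rightarrow> ('b :: complex_inner \<Rightarrow>\<^sub>L 'b)) \<Rightarrow> bool" where
  "multiplicative_on A \<phi> \<longleftrightarrow> (\<forall>S\<in>A. \<forall>T\<in>A. \<phi> (S o\<^sub>L T) = \<phi> S o\<^sub>L \<phi> T)"


section \<open>Strict convexity\<close>

definition strictly_convex_on :: "real set \<Rightarrow> (real \<Rightarrow> real) \<Rightarrow> bool" where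
  "strictly_convex_on S f \<longleftrightarrow> convex S \<and>
     (\<forall>x\<in>S. \<forall>y\<in>S. \<forall>t. x \<noteq> y \<longrightarrow> 0 < t \<longrightarrow> t < 1 \<longrightarrow>
        f ((1 - t) * x + t * y) < (1 - t) * f x + t * f y)"

end

theory Submission
  imports Defs "HOL-Computational_Algebra.Fundamental_Theorem_Algebra"
begin

text \<open>Write \<open>K = \<phi>(H)\<close> and call a continuous function \<open>g\<close> preserved if \<open>\<phi>(g(H)) = g(K)\<close>. Affine
  functions and \<open>f\<close> are preserved. To see that each hinge \<open>(t - c)\<^sub>+\<close> is preserved, split a vector with a
  fine partition of unity in \<open>K\<close> into pieces \<open>y\<^sub>k\<close> that are localised near points \<open>p\<^sub>k\<close>. As \<open>f\<close> minus its tangent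
  at \<open>p\<^sub>k\<close> is preserved, nonnegative and small near \<open>p\<^sub>k\<close>, but by strict convexity bounded below away from
  \<open>p\<^sub>k\<close>, Kadison's inequality makes \<open>\<phi>((H - c)\<^sub>+) y\<^sub>k\<close> small for \<open>p\<^sub>k < c\<close>. Symmetrically, \<open>\<phi>((c - H)\<^sub>+) y\<^sub>k\<close>
  is small for \<open>p\<^sub>k > c\<close>, and the two hinges differ by an affine function. The errors are second differences
  of \<open>f\<close>, whose sum telescopes.

  The square is a uniform limit of combinations of hinges and affine functions, so \<open>\<phi>(H\<^sup>2) = K\<^sup>2\<close>, and
  polarising Kadison's inequality then gives \<open>\<phi>(H\<^sup>n) = K\<^sup>n\<close> for all \<open>n\<close>.\<close>

section \<open>The real inner product\<close>

text \<open>The images of the pieces \<open>y\<^sub>k\<close> under the defect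
  \<open>\<phi>(w(H)) - w(K)\<close> of a hinge \<open>w\<close> need not be orthogonal, so their
  norms are combined by the triangle inequality and Cauchy-Schwarz. The total error is then governed
  by the sum of the local errors, while the number of pieces grows as the mesh shrinks; local errors
  that are merely uniformly small would not do. The sum must stay small even if the slopes of
  \<open>f\<close> blow up at an endpoint, as for \<open>- sqrt t\<close> at 0, where no tangent
  exists either. Each piece may pick the hinge that vanishes on its own side of \<open>c\<close>,
  because two functions with affine difference have the same defect.

  Since \<open>cfc\<close> is a definite description, nothing can be said about \<open>f(H)\<close>
  before the norm of \<open>p(T)\<close> is bounded by the supremum of \<open>p\<close> on the
  spectrum. That bound is drawn from the C*-identity and the factorisation of complex
  polynomials.\<close>

definition rinner :: "'a :: complex_inner \<Rightarrow> 'a \<Rightarrow> real" where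
  "rinner x y = Re (cinner x y)"

lemma scaleC_one [simp]: "1 *\<^sub>C x = (x :: 'a :: complex_vector)"
  using scaleC_of_real[of 1 x] by simp

lemma scaleC_zero_left [simp]: "0 *\<^sub>C x = (0 :: 'a :: complex_vector)"
  using scaleC_of_real[of 0 x] by simp

lemma scaleC_minus_left: "(- c) *\<^sub>C x = - (c *\<^sub>C x :: 'a :: complex_vector)"
  using scaleC_add_left[of "- c" c x] by (simp add: eq_neg_iff_add_eq_0)

lemma scaleC_zero_right [simp]: "c *\<^sub>C 0 = (0 :: 'a :: complex_vector)"
  using scaleC_add_right[of c 0 0] by simp

lemma scaleC_minus_right: "c *\<^sub>C (- x) = - (c *\<^sub>C x :: 'a :: complex_vector)"
  using scaleC_add_right[of c x "- x"] by (simp add: eq_neg_iff_add_eq_0 add.commute)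

lemma scaleC_diff_right: "c *\<^sub>C (x - y) = c *\<^sub>C x - (c *\<^sub>C y :: 'a :: complex_vector)"
  using scaleC_add_right[of c x "- y"] by (simp add: scaleC_minus_right)

lemma scaleC_sum_right: "c *\<^sub>C (\<Sum>i\<in>I. g i) = (\<Sum>i\<in>I. c *\<^sub>C (g i :: 'a :: complex_vector))"
  by (induction I rule: infinite_finite_induct) (simp_all add: scaleC_add_right)

lemma scaleR_scaleC: "r *\<^sub>R x = of_real r *\<^sub>C (x :: 'a :: complex_vector)"
  by (simp add: scaleC_of_real)

lemma cinner_add_left: "cinner (x + y) z = cinner x z + cinner y z"
  by (metis cinner_commute cinner_add_right complex_cnj_add)

lemma cinner_zero_left [simp]: "cinner 0 y = 0" and cinner_zero_right [simp]: "cinner y 0 = 0"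
  using cinner_add_left[of 0 0 y] cinner_add_right[of y 0 0] by auto

lemma cinner_scaleC_left: "cinner (c *\<^sub>C x) y = cnj c * cinner x y"
  by (metis cinner_commute cinner_scaleC_right complex_cnj_mult)

lemma cinner_scaleR_right: "cinner x (r *\<^sub>R y) = of_real r * cinner x y"
  by (simp add: scaleR_scaleC cinner_scaleC_right)

lemma rinner_commute: "rinner x y = rinner y x"
  unfolding rinner_def using cinner_commute[of x y] by simp

lemma rinner_add_right: "rinner x (y + z) = rinner x y + rinner x z"
  by (simp add: rinner_def cinner_add_right)

lemma rinner_scaleR_right: "rinner x (r *\<^sub>R y) = r * rinner x y"
  by (simp add: rinner_def cinner_scaleR_right)

lemma rinner_add_left: "rinner (y + z) x = rinner y x + rinner z x"
  by (metis rinner_commute rinner_add_right)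

lemma rinner_scaleR_left: "rinner (r *\<^sub>R y) x = r * rinner y x"
  by (metis rinner_commute rinner_scaleR_right)

lemma rinner_self: "rinner x x = (norm x)\<^sup>2"
  by (simp add: rinner_def cinner_self)

lemma norm_add_square: "(norm (x + y))\<^sup>2 = (norm x)\<^sup>2 + 2 * rinner x y + (norm y)\<^sup>2"
  using rinner_commute[of x y]
  by (simp add: rinner_self[symmetric] rinner_add_left rinner_add_right)

lemma rinner_le_norm: "rinner x y \<le> norm x * norm y"
proof -
  have "(norm (x + y))\<^sup>2 \<le> (norm x + norm y)\<^sup>2"
    by (intro power_mono norm_triangle_ineq) auto
  then show ?thesis
    by (simp add: norm_add_square power2_sum)
qed

lemma abs_rinner_le_norm: "\<bar>rinner x y\<bar> \<le> norm x * norm y"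
  using rinner_le_norm[of x y] rinner_le_norm[of x "- y"] rinner_scaleR_right[of x "-1" y]
  by (simp add: abs_le_iff)

lemma bounded_bilinear_rinner: "bounded_bilinear rinner"
  by (rule bounded_bilinear.intro)
     (auto simp: rinner_add_left rinner_add_right rinner_scaleR_left rinner_scaleR_right
        abs_rinner_le_norm intro!: exI[of _ 1])

interpretation rinner: bounded_bilinear rinner
  by (rule bounded_bilinear_rinner)

lemma norm_diff_square: "(norm (x - y))\<^sup>2 = (norm x)\<^sup>2 - 2 * rinner x y + (norm y)\<^sup>2"
  using norm_add_square[of x "- y"] by (simp add: rinner.minus_right)

lemma rinner_eqI:
  assumes "\<And>y. rinner u y = rinner v y"
  shows "u = v"
proof -
  have "rinner (u - v) (u - v) = 0"
    using assms by (simp add: rinner.diff_left)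
  then show ?thesis by (simp add: rinner_self)
qed

text \<open>Nothing is lost in passing to real parts: the full inner product can be recovered from
  \<open>rinner\<close>, so real inequalities and real polarisation serve for complex
  operators.\<close>

lemma Im_cinner: "Im (cinner x y) = rinner (\<i> *\<^sub>C x) y"
  by (simp add: rinner_def cinner_scaleC_left)


section \<open>The algebra of bounded operators\<close>

lemmas scaleC_blinfun_apply [simp] = scaleC_blinfun.rep_eq

lemma bounded_opsD: "T \<in> bounded_ops \<Longrightarrow> T (c *\<^sub>C x) = c *\<^sub>C T x"
  by (simp add: bounded_ops_def)

lemma bounded_ops_id [simp]: "id_blinfun \<in> bounded_ops"
  by (simp add: bounded_ops_def)

lemma bounded_ops_zero [simp]: "0 \<in> bounded_ops"
  by (simp add: bounded_ops_def)

lemma bounded_ops_add [simp]: "S \<in> bounded_ops \<Longrightarrow> T \<in> bounded_ops \<Longrightarrow> S + T \<in> bounded_ops"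
  by (simp add: bounded_ops_def plus_blinfun.rep_eq scaleC_add_right)

lemma bounded_ops_diff [simp]: "S \<in> bounded_ops \<Longrightarrow> T \<in> bounded_ops \<Longrightarrow> S - T \<in> bounded_ops"
  by (simp add: bounded_ops_def minus_blinfun.rep_eq scaleC_diff_right)

lemma bounded_ops_scaleC [simp]: "T \<in> bounded_ops \<Longrightarrow> c *\<^sub>C T \<in> bounded_ops"
  by (simp add: bounded_ops_def scaleC_scaleC mult.commute)

lemma bounded_ops_scaleR [simp]: "T \<in> bounded_ops \<Longrightarrow> c *\<^sub>R T \<in> bounded_ops"
  by (simp add: scaleR_scaleC)

lemma bounded_ops_compose [simp]:
  "S \<in> bounded_ops \<Longrightarrow> T \<in> bounded_ops \<Longrightarrow> S o\<^sub>L T \<in> bounded_ops"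
  by (simp add: bounded_ops_def)

lemma bounded_ops_sum: "(\<And>i. i \<in> I \<Longrightarrow> T i \<in> bounded_ops) \<Longrightarrow> (\<Sum>i\<in>I. T i) \<in> bounded_ops"
  by (induction I rule: infinite_finite_induct) auto

lemma bounded_ops_funpow: "T \<in> bounded_ops \<Longrightarrow> ((o\<^sub>L) T ^^ n) id_blinfun \<in> bounded_ops"
  by (induction n) auto

text \<open>The ambient type contains all bounded real-linear maps, so complex linearity of a norm
  limit has to be checked, pointwise.\<close>

lemma bounded_ops_limit:
  assumes "\<And>n. X n \<in> bounded_ops" and "X \<longlonglongrightarrow> S"
  shows "S \<in> bounded_ops"
  unfolding bounded_ops_def
proof (intro CollectI allI)
  fix c x
  have "(\<lambda>n. X n (c *\<^sub>C x)) \<longlonglongrightarrow> S (c *\<^sub>C x)"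
    by (intro blinfun.tendsto assms tendsto_const)
  moreover have "(\<lambda>n. c *\<^sub>C X n x) \<longlonglongrightarrow> c *\<^sub>C S x"
    by (intro bounded_linear.tendsto[OF bounded_linear_scaleC] blinfun.tendsto assms tendsto_const)
  ultimately show "S (c *\<^sub>C x) = c *\<^sub>C S x"
    using assms(1) by (simp add: bounded_opsD LIMSEQ_unique)
qed

lemma scaleC_compose_left: "(c *\<^sub>C S) o\<^sub>L T = c *\<^sub>C (S o\<^sub>L T)"
  by (rule blinfun_eqI) simp

lemma scaleC_compose_right: "S \<in> bounded_ops \<Longrightarrow> S o\<^sub>L (c *\<^sub>C T) = c *\<^sub>C (S o\<^sub>L T)"
  by (rule blinfun_eqI) (simp add: bounded_opsD)

lemma id_compose [simp]: "id_blinfun o\<^sub>L T = T" "T o\<^sub>L id_blinfun = T"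
  by (auto intro: blinfun_eqI)

lemma compose_assoc: "(S o\<^sub>L T) o\<^sub>L U = S o\<^sub>L (T o\<^sub>L U)"
  by (auto intro: blinfun_eqI)

lemma compose_add_left: "(S + T) o\<^sub>L U = (S o\<^sub>L U) + (T o\<^sub>L U)"
  by (auto intro: blinfun_eqI simp: plus_blinfun.rep_eq)


section \<open>Polynomials of an operator\<close>

text \<open>Any bound on the degree may replace \<open>degree p\<close>; two polynomials can then be
  summed over a common range even if leading terms cancel.\<close>

lemma poly_op_eq_sum:
  assumes "degree p \<le> n"
  shows "poly_op p T = (\<Sum>i\<le>n. coeff p i *\<^sub>C (((o\<^sub>L) T ^^ i) id_blinfun))"
  unfolding poly_op_def
  by (rule sum.mono_neutral_left) (use assms in \<open>auto simp: coeff_eq_0\<close>)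

lemma poly_op_0 [simp]: "poly_op 0 T = 0"
  by (simp add: poly_op_def)

lemma poly_op_const [simp]: "poly_op [:c:] T = c *\<^sub>C id_blinfun"
  by (simp add: poly_op_def)

lemma poly_op_pCons:
  assumes "T \<in> bounded_ops"
  shows "poly_op (pCons c p) T = c *\<^sub>C id_blinfun + (T o\<^sub>L poly_op p T)"
proof -
  have "poly_op (pCons c p) T =
      (\<Sum>i\<le>Suc (degree p). coeff (pCons c p) i *\<^sub>C (((o\<^sub>L) T ^^ i) id_blinfun))"
    by (rule poly_op_eq_sum) (simp add: degree_pCons_eq_if)
  also have "\<dots> = c *\<^sub>C id_blinfun
      + (\<Sum>i\<le>degree p. T o\<^sub>L (coeff p i *\<^sub>C (((o\<^sub>L) T ^^ i) id_blinfun)))"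
    by (simp add: sum.atMost_Suc_shift scaleC_compose_right[OF assms] del: sum.atMost_Suc)
  also have "(\<Sum>i\<le>degree p. T o\<^sub>L (coeff p i *\<^sub>C (((o\<^sub>L) T ^^ i) id_blinfun))) =
      T o\<^sub>L poly_op p T"
    unfolding poly_op_def
    by (rule bounded_bilinear.sum_right[OF bounded_bilinear_blinfun_compose, symmetric])
  finally show ?thesis .
qed

lemma poly_op_in_bounded_ops [simp]: "T \<in> bounded_ops \<Longrightarrow> poly_op p T \<in> bounded_ops"
  unfolding poly_op_def by (intro bounded_ops_sum bounded_ops_scaleC bounded_ops_funpow)

lemma poly_op_add: "poly_op (p + q) T = poly_op p T + poly_op q T"
proof -
  have "degree (p + q) \<le> max (degree p) (degree q)"
    by (rule degree_add_le_max)
  then show ?thesis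
    by (simp add: poly_op_eq_sum[where n = "max (degree p) (degree q)"] scaleC_add_left
        sum.distrib)
qed

lemma poly_op_smult: "poly_op (smult c p) T = c *\<^sub>C poly_op p T"
  by (simp add: poly_op_eq_sum[where n = "degree p"] degree_smult_le scaleC_sum_right scaleC_scaleC)

lemma poly_op_diff: "poly_op (p - q) T = poly_op p T - poly_op q T"
  using poly_op_add[of p "- q" T] poly_op_smult[of "- 1" q T] by (simp add: scaleC_minus_left)

lemma poly_op_mult:
  assumes "T \<in> bounded_ops"
  shows "poly_op (p * q) T = poly_op p T o\<^sub>L poly_op q T"
proof (induction p)
  case (pCons c p)
  have "poly_op (pCons c p * q) T = poly_op (smult c q) T + poly_op (pCons 0 (p * q)) T"
    by (simp add: poly_op_add)
  also have "\<dots> = poly_op (pCons c p) T o\<^sub>L poly_op q T"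
    by (simp add: poly_op_smult poly_op_pCons[OF assms] pCons.IH compose_add_left
        scaleC_compose_left compose_assoc)
  finally show ?case .
qed simp

lemma poly_op_X [simp]: "T \<in> bounded_ops \<Longrightarrow> poly_op [:0, 1:] T = T"
  by (simp add: poly_op_pCons)

lemma poly_op_commute:
  assumes "T \<in> bounded_ops"
  shows "poly_op p T o\<^sub>L poly_op q T = poly_op q T o\<^sub>L poly_op p T"
  by (metis poly_op_mult[OF assms] mult.commute)

lemma poly_op_adjoint:
  assumes "selfadjoint_op T"
  shows "cinner (poly_op p T x) y = cinner x (poly_op (map_poly cnj p) T y)"
proof (induction p arbitrary: x y)
  case (pCons c p)
  have T: "T \<in> bounded_ops" and sa: "cinner (T x) y = cinner x (T y)" for x y
    using assms by (auto simp: selfadjoint_op_def)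
  have comm: "poly_op q T (T z) = T (poly_op q T z)" for q z
    by (metis blinfun_apply_blinfun_compose poly_op_X poly_op_commute T)
  show ?case
    by (simp add: map_poly_pCons poly_op_pCons[OF T] plus_blinfun.rep_eq cinner_add_left
        cinner_add_right cinner_scaleC_left cinner_scaleC_right sa pCons.IH comm)
qed simp

section \<open>Spectrum of a self-adjoint operator\<close>

definition invertible_op :: "('a :: complex_inner \<Rightarrow>\<^sub>L 'a) \<Rightarrow> bool" where
  "invertible_op T \<longleftrightarrow> (\<exists>S\<in>bounded_ops. S o\<^sub>L T = id_blinfun \<and> T o\<^sub>L S = id_blinfun)"

lemma op_spectrum_iff: "c \<in> op_spectrum T \<longleftrightarrow> \<not> invertible_op (T - c *\<^sub>C id_blinfun)"
  by (simp add: op_spectrum_def invertible_op_def)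

lemma invertible_op_compose:
  assumes "invertible_op S" and "invertible_op T"
  shows "invertible_op (S o\<^sub>L T)"
proof -
  obtain S' T' where "S' \<in> bounded_ops" "T' \<in> bounded_ops"
    and S': "S' o\<^sub>L S = id_blinfun" "S o\<^sub>L S' = id_blinfun"
    and T': "T' o\<^sub>L T = id_blinfun" "T o\<^sub>L T' = id_blinfun"
    using assms by (auto simp: invertible_op_def)
  moreover have "(T' o\<^sub>L S') o\<^sub>L (S o\<^sub>L T) = id_blinfun"
    by (metis S' T' compose_assoc id_compose(1))
  moreover have "(S o\<^sub>L T) o\<^sub>L (T' o\<^sub>L S') = id_blinfun"
    by (metis S' T' compose_assoc id_compose(1))
  ultimately show ?thesis
    unfolding invertible_op_def by (meson bounded_ops_compose)
qed

text \<open>If \<open>U\<close> inverts the product, then \<open>U S\<close> is a left inverse of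
  \<open>T\<close> and, by commutation, \<open>S U\<close> is a right inverse; associativity makes
  the two equal.\<close>

lemma invertible_op_factor:
  assumes "invertible_op (S o\<^sub>L T)" and "S o\<^sub>L T = T o\<^sub>L S"
    and "S \<in> bounded_ops" "T \<in> bounded_ops"
  shows "invertible_op T"
proof -
  obtain U where U: "U \<in> bounded_ops" "U o\<^sub>L (S o\<^sub>L T) = id_blinfun" "(S o\<^sub>L T) o\<^sub>L U = id_blinfun"
    using assms(1) by (auto simp: invertible_op_def)
  have left: "(U o\<^sub>L S) o\<^sub>L T = id_blinfun"
    using U by (simp add: compose_assoc)
  have right: "T o\<^sub>L (S o\<^sub>L U) = id_blinfun"
    using U assms(2) by (simp add: compose_assoc)
  have "U o\<^sub>L S = S o\<^sub>L U"
    by (metis left right compose_assoc id_compose)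
  with left right show ?thesis
    unfolding invertible_op_def using U(1) assms(3) by (metis bounded_ops_compose)
qed

text \<open>The equation \<open>T x = y\<close> is solved as the fixed point of \<open>x \<mapsto> x - r (T x - y)\<close>, a contraction
  for \<open>r = m / M\<^sup>2\<close>.\<close>

lemma coercive_bij:
  fixes T :: "'a :: chilbert_space \<Rightarrow>\<^sub>L 'a"
  assumes "m > 0" and coercive: "\<And>x. m * (norm x)\<^sup>2 \<le> rinner x (T x)"
  shows "bij (blinfun_apply T)"
proof -
  \<comment> \<open>Adding \<open>m\<close> gives \<open>0 < m \<le> M\<close> also on the trivial
    space, where \<open>norm T = 0\<close>.\<close>
  define M where "M = norm T + m"
  define r where "r = m / M\<^sup>2"
  have "M > 0" and mM: "m \<le> M"
    using assms(1) norm_ge_zero[of T] unfolding M_def by linarith+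
  have nT: "norm (T x) \<le> M * norm x" for x
    using norm_blinfun[of T x] assms(1)
    by (simp add: M_def distrib_right add_increasing2)
  have r: "r > 0" using assms(1) \<open>M > 0\<close> by (simp add: r_def)
  \<comment> \<open>The minimum of \<open>1 - 2 * r * m + r\<^sup>2 * M\<^sup>2\<close> over
    \<open>r\<close>, attained at the chosen \<open>r\<close>; its square root is the contraction
    constant.\<close>
  define k where "k = 1 - m\<^sup>2 / M\<^sup>2"
  have k: "0 \<le> k" "k < 1"
    using mM assms(1) \<open>M > 0\<close> by (auto simp: k_def power_mono)
  have contr: "norm (x - r *\<^sub>R T x) \<le> sqrt k * norm x" for x
  proof -
    have "(norm (x - r *\<^sub>R T x))\<^sup>2 = (norm x)\<^sup>2 - 2 * r * rinner x (T x) + r\<^sup>2 * (norm (T x))\<^sup>2"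
      by (simp add: norm_diff_square rinner.scaleR_right power_mult_distrib)
    also have "\<dots> \<le> (norm x)\<^sup>2 - 2 * r * (m * (norm x)\<^sup>2) + r\<^sup>2 * (M * norm x)\<^sup>2"
      using coercive[of x] nT[of x] r by (intro add_mono diff_mono mult_left_mono power_mono) auto
    also have "\<dots> = k * (norm x)\<^sup>2"
      using \<open>M > 0\<close> by (simp add: r_def k_def power2_eq_square field_simps)
    also have "\<dots> = (sqrt k * norm x)\<^sup>2"
      using k by (simp add: power_mult_distrib)
    finally show ?thesis
      by (rule power2_le_imp_le) (use k in simp)
  qed
  have ex1: "\<exists>!x. x - r *\<^sub>R (T x - y) = x" for y
  proof (rule banach_fix_type)
    show "0 \<le> sqrt k" "sqrt k < 1"
      using k by auto
    show "\<forall>x z. dist (x - r *\<^sub>R (T x - y)) (z - r *\<^sub>R (T z - y)) \<le> sqrt k * dist x z"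
    proof (intro allI)
      fix x z
      have "x - r *\<^sub>R (T x - y) - (z - r *\<^sub>R (T z - y)) = (x - z) - r *\<^sub>R T (x - z)"
        by (simp add: blinfun.diff_right algebra_simps)
      then show "dist (x - r *\<^sub>R (T x - y)) (z - r *\<^sub>R (T z - y)) \<le> sqrt k * dist x z"
        using contr[of "x - z"] by (simp only: dist_norm)
    qed
  qed
  have "\<exists>!x. T x = y" for y
    using ex1[of y] r by simp
  then show ?thesis
    by (simp add: bij_iff)
qed

text \<open>The Lax-Milgram argument: coercivity and Cauchy-Schwarz give
  \<open>m * norm x \<le> norm (T x)\<close>, which bounds the inverse by \<open>1 / m\<close>; the
  inverse inherits complex linearity because \<open>T\<close> is injective.\<close>

lemma invertible_op_coercive:
  fixes T :: "'a :: chilbert_space \<Rightarrow>\<^sub>L 'a"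
  assumes "T \<in> bounded_ops" and "m > 0" and coercive: "\<And>x. m * (norm x)\<^sup>2 \<le> rinner x (T x)"
  shows "invertible_op T"
proof -
  define g where "g = inv (blinfun_apply T)"
  have bij: "bij (blinfun_apply T)"
    by (rule coercive_bij[OF assms(2) coercive])
  have Tg: "T (g y) = y" and gT: "g (T y) = y" for y
    using bij by (auto simp: g_def bij_is_surj bij_is_inj surj_f_inv_f)
  have eqI: "T x = T y \<Longrightarrow> x = y" for x y
    by (metis gT)
  have bound: "m * norm x \<le> norm (T x)" for x
  proof (cases "x = 0")
    case False
    have "m * norm x * norm x \<le> norm (T x) * norm x"
      using coercive[of x] rinner_le_norm[of x "T x"] by (simp add: power2_eq_square algebra_simps)
    then show ?thesis using False by simp
  qed simp
  have "bounded_linear g"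
  proof (rule bounded_linear_intro)
    show "g (x + y) = g x + g y" for x y
      by (rule eqI) (simp add: Tg blinfun.add_right)
    show "g (c *\<^sub>R x) = c *\<^sub>R g x" for c x
      by (rule eqI) (simp add: Tg blinfun.scaleR_right)
    show "norm (g x) \<le> norm x * (1 / m)" for x
      using bound[of "g x"] assms(2) by (simp add: Tg field_simps)
  qed
  then have G: "blinfun_apply (Blinfun g) = g"
    by (rule bounded_linear_Blinfun_apply)
  have "g (c *\<^sub>C x) = c *\<^sub>C g x" for c x
    by (rule eqI) (simp add: Tg bounded_opsD[OF assms(1)])
  then have "Blinfun g \<in> bounded_ops"
    by (simp add: bounded_ops_def G)
  then show ?thesis
    unfolding invertible_op_def
    by (intro bexI[of _ "Blinfun g"]) (auto intro!: blinfun_eqI simp: G Tg gT)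
qed

lemma selfadjoint_opD:
  assumes "selfadjoint_op T"
  shows "T \<in> bounded_ops" "cinner (T x) y = cinner x (T y)" "rinner (T x) y = rinner x (T y)"
  using assms by (auto simp: selfadjoint_op_def rinner_def)

lemma selfadjoint_opI:
  assumes T: "T \<in> bounded_ops" and "\<And>x y. rinner (T x) y = rinner x (T y)"
  shows "selfadjoint_op T"
proof -
  have "Im (cinner (T x) y) = Im (cinner x (T y))" for x y
    using assms(2)[of "\<i> *\<^sub>C x" y] by (simp add: Im_cinner bounded_opsD[OF T])
  with assms show ?thesis
    by (auto simp: selfadjoint_op_def rinner_def complex_eq_iff)
qed

lemma selfadjoint_op_linear_factor:
  assumes "selfadjoint_op T"
  shows "cinner ((T - c *\<^sub>C id_blinfun) x) y = cinner x ((T - cnj c *\<^sub>C id_blinfun) y)"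
proof -
  have "poly_op [:- d, 1:] T = T - d *\<^sub>C id_blinfun" for d
    using selfadjoint_opD(1)[OF assms] by (simp add: poly_op_pCons scaleC_minus_left)
  moreover have "map_poly cnj [:- c, 1:] = [:- cnj c, 1:]"
    by (simp add: map_poly_pCons)
  ultimately show ?thesis
    using poly_op_adjoint[OF assms, of "[:- c, 1:]" x y] by simp
qed

text \<open>An operator that is bounded below need not be onto. But the product of
  \<open>T - c\<close> with its adjoint \<open>T - cnj c\<close> is coercive with constant
  \<open>d\<^sup>2\<close>, hence invertible, and the factors commute as polynomials in
  \<open>T\<close>.\<close>

lemma not_in_op_spectrum:
  fixes T :: "'a :: chilbert_space \<Rightarrow>\<^sub>L 'a"
  assumes sa: "selfadjoint_op T" and "d > 0"
    and below: "\<And>x. d * norm x \<le> norm ((T - c *\<^sub>C id_blinfun) x)"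
  shows "c \<notin> op_spectrum T"
proof -
  let ?A = "T - c *\<^sub>C id_blinfun" and ?B = "T - cnj c *\<^sub>C id_blinfun"
  note T = selfadjoint_opD(1)[OF sa]
  have poly: "?A = poly_op [:- c, 1:] T" "?B = poly_op [:- cnj c, 1:] T"
    using T by (simp_all add: poly_op_pCons scaleC_minus_left)
  have comm: "?B o\<^sub>L ?A = ?A o\<^sub>L ?B"
    unfolding poly by (rule poly_op_commute[OF T])
  have ops: "?A \<in> bounded_ops" "?B \<in> bounded_ops"
    using T by auto
  have "invertible_op (?B o\<^sub>L ?A)"
  proof (rule invertible_op_coercive)
    show "?B o\<^sub>L ?A \<in> bounded_ops" using ops by simp
    show "0 < d\<^sup>2" using assms(2) by simp
    fix x
    have "rinner x ((?B o\<^sub>L ?A) x) = rinner (?A x) (?A x)"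
      unfolding rinner_def selfadjoint_op_linear_factor[OF sa, of c x "?A x"] by simp
    then show "d\<^sup>2 * (norm x)\<^sup>2 \<le> rinner x ((?B o\<^sub>L ?A) x)"
      using power_mono[OF below[of x], of 2] assms(2) by (simp add: rinner_self power_mult_distrib)
  qed
  then show ?thesis
    using invertible_op_factor[OF _ comm ops(2,1)] by (simp add: op_spectrum_iff)
qed

text \<open>For \<open>c\<close> off the segment, pairing \<open>(T - c) x\<close> with
  \<open>x\<close> or with \<open>\<i> x\<close> bounds \<open>T - c\<close> below; the constants
  are \<open>\<bar>Im c\<bar>\<close>, \<open>a - Re c\<close> and \<open>Re c - b\<close>, at least
  one of which is positive.\<close>

lemma op_spectrum_selfadjoint:
  fixes T :: "'a :: chilbert_space \<Rightarrow>\<^sub>L 'a"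
  assumes sa: "selfadjoint_op T"
    and lower: "\<And>x. a * (norm x)\<^sup>2 \<le> rinner x (T x)"
    and upper: "\<And>x. rinner x (T x) \<le> b * (norm x)\<^sup>2"
  shows "op_spectrum T \<subseteq> complex_of_real ` {a..b}"
proof
  fix c assume c: "c \<in> op_spectrum T"
  have re: "rinner x ((T - c *\<^sub>C id_blinfun) x) = rinner x (T x) - Re c * (norm x)\<^sup>2" for x
    by (simp add: minus_blinfun.rep_eq rinner.diff_right)
       (simp add: rinner_def cinner_scaleC_right cinner_self flip: of_real_power)
  have im: "rinner (\<i> *\<^sub>C x) ((T - c *\<^sub>C id_blinfun) x) = - Im c * (norm x)\<^sup>2" for x
  proof -
    have "cinner x (T x) = cnj (cinner x (T x))"
      by (metis cinner_commute selfadjoint_opD(2)[OF sa])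
    then have "Im (cinner x (T x)) = 0"
      by (metis cnj.sel(2) complex_cnj_cancel_iff eq_neg_iff_add_eq_0 neg_equal_zero)
    then show ?thesis
      by (simp add: minus_blinfun.rep_eq rinner.diff_right)
         (simp add: rinner_def cinner_scaleC_left cinner_scaleC_right cinner_self flip: of_real_power)
  qed
  have nonpos: "d \<le> 0" if "\<And>x. d * (norm x)\<^sup>2 \<le> norm x * norm ((T - c *\<^sub>C id_blinfun) x)" for d
  proof (rule ccontr)
    assume "\<not> d \<le> 0"
    have "d * norm x \<le> norm ((T - c *\<^sub>C id_blinfun) x)" for x
      using that[of x] by (cases "x = 0") (auto simp: power2_eq_square algebra_simps)
    then show False
      using not_in_op_spectrum[OF sa, of d c] c \<open>\<not> d \<le> 0\<close> by simp
  qed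
  have ni: "norm (\<i> *\<^sub>C x) = norm x" for x :: 'a
    by (simp add: norm_scaleC)
  have "\<bar>Im c\<bar> \<le> 0"
  proof (rule nonpos)
    fix x
    show "\<bar>Im c\<bar> * (norm x)\<^sup>2 \<le> norm x * norm ((T - c *\<^sub>C id_blinfun) x)"
      using abs_rinner_le_norm[of "\<i> *\<^sub>C x" "(T - c *\<^sub>C id_blinfun) x"]
      by (simp only: im ni abs_mult abs_minus_cancel abs_power2)
  qed
  moreover have "a - Re c \<le> 0"
  proof (rule nonpos)
    fix x
    show "(a - Re c) * (norm x)\<^sup>2 \<le> norm x * norm ((T - c *\<^sub>C id_blinfun) x)"
      using abs_rinner_le_norm[of x "(T - c *\<^sub>C id_blinfun) x"] lower[of x]
      by (simp only: re) (simp add: algebra_simps)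
  qed
  moreover have "Re c - b \<le> 0"
  proof (rule nonpos)
    fix x
    show "(Re c - b) * (norm x)\<^sup>2 \<le> norm x * norm ((T - c *\<^sub>C id_blinfun) x)"
      using abs_rinner_le_norm[of x "(T - c *\<^sub>C id_blinfun) x"] upper[of x]
      by (simp only: re) (simp add: algebra_simps)
  qed
  ultimately have "c = complex_of_real (Re c)" "Re c \<in> {a..b}"
    by (auto simp: complex_eq_iff)
  then show "c \<in> complex_of_real ` {a..b}" by blast
qed

section \<open>The norm of a polynomial in a self-adjoint operator\<close>

lemma invertible_poly_op:
  assumes T: "T \<in> bounded_ops"
  shows "p \<noteq> 0 \<Longrightarrow> (\<And>z. z \<in> op_spectrum T \<Longrightarrow> poly p z \<noteq> 0) \<Longrightarrow> invertible_op (poly_op p T)"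
proof (induction "degree p" arbitrary: p)
  case 0
  then obtain c where p: "p = [:c:]" "c \<noteq> 0"
    by (metis degree_0_id degree_eq_zeroE pCons_eq_0_iff)
  show ?case
    unfolding invertible_op_def p
    by (intro bexI[of _ "inverse c *\<^sub>C id_blinfun"])
       (use p in \<open>auto intro!: blinfun_eqI simp: scaleC_scaleC\<close>)
next
  case (Suc n)
  then have "\<not> constant (poly p)"
    by (simp add: constant_degree)
  then obtain r where r: "poly p r = 0"
    using fundamental_theorem_of_algebra by blast
  \<comment> \<open>A root \<open>r\<close> of \<open>p\<close> lies outside the spectrum, so it
    splits off an invertible factor \<open>T - r\<close>.\<close>
  then obtain q where pq: "p = [:- r, 1:] * q"
    by (metis poly_eq_0_iff_dvd dvdE)
  have "q \<noteq> 0" using pq Suc.prems by auto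
  have "degree p = Suc (degree q)"
    unfolding pq using \<open>q \<noteq> 0\<close> by (subst degree_mult_eq) auto
  then have "invertible_op (poly_op q T)"
    using Suc.hyps Suc.prems \<open>q \<noteq> 0\<close> pq by (intro Suc.hyps(1)) auto
  moreover have "invertible_op (T - r *\<^sub>C id_blinfun)"
    using Suc.prems(2) r op_spectrum_iff by blast
  moreover have "poly_op [:- r, 1:] T = T - r *\<^sub>C id_blinfun"
    using T by (simp add: poly_op_pCons scaleC_minus_left)
  ultimately show ?case
    unfolding pq poly_op_mult[OF T] by (simp add: invertible_op_compose)
qed

text \<open>The C*-identity in the form that \<open>\<parallel>A\<parallel>\<^sup>2\<close> lies in the spectrum of \<open>A\<^sup>* A\<close>.\<close>

lemma norm_square_in_spectrum:
  fixes A A' :: "'a :: complex_inner \<Rightarrow>\<^sub>L 'a"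
  assumes adj: "\<And>x y. cinner (A x) y = cinner x (A' y)" and "A \<noteq> 0"
  shows "\<not> invertible_op ((A' o\<^sub>L A) - of_real ((norm A)\<^sup>2) *\<^sub>C id_blinfun)"
proof
  define N where "N = norm A"
  have "N > 0" using assms(2) by (simp add: N_def)
  have adj': "rinner (A x) y = rinner x (A' y)" for x y
    by (simp add: rinner_def adj)
  let ?Q = "(A' o\<^sub>L A) - of_real ((norm A)\<^sup>2) *\<^sub>C id_blinfun"
  assume "invertible_op ?Q"
  then obtain S where "S o\<^sub>L ?Q = id_blinfun"
    by (auto simp: invertible_op_def)
  then have S: "S (?Q x) = x" for x
    by (metis blinfun_apply_blinfun_compose blinfun_apply_id_blinfun)
  have A: "norm (A x) \<le> N * norm x" for x
    using norm_blinfun[of A x] by (simp add: N_def)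
  \<comment> \<open>Nothing but the adjoint relation is known about \<open>A'\<close>; testing it on
    \<open>A (A' z)\<close> gives the same bound \<open>N\<close>.\<close>
  have A': "norm (A' z) \<le> N * norm z" for z
  proof (cases "A' z = 0")
    case False
    have "(norm (A' z))\<^sup>2 = rinner (A (A' z)) z"
      by (simp add: adj' rinner_self)
    also have "\<dots> \<le> N * norm (A' z) * norm z"
      using rinner_le_norm[of "A (A' z)" z] mult_right_mono[OF A[of "A' z"], of "norm z"] by simp
    finally show ?thesis using False by (simp add: power2_eq_square)
  qed (use \<open>N > 0\<close> in simp)
  \<comment> \<open>A vector on which \<open>A\<close> nearly attains its norm is nearly an
    eigenvector of \<open>A' A\<close> for \<open>N\<^sup>2\<close>, which a bounded inverse of
    \<open>?Q\<close> forbids. The factor 2 is slack.\<close>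
  have Q: "(norm (?Q x))\<^sup>2 \<le> 2 * N\<^sup>2 * (N\<^sup>2 * (norm x)\<^sup>2 - (norm (A x))\<^sup>2)" for x
  proof -
    have "?Q x = A' (A x) - N\<^sup>2 *\<^sub>R x"
      by (simp add: minus_blinfun.rep_eq N_def scaleR_scaleC)
    moreover have "rinner (A' (A x)) x = (norm (A x))\<^sup>2"
      by (metis adj' rinner_commute rinner_self)
    ultimately have "(norm (?Q x))\<^sup>2 = (norm (A' (A x)))\<^sup>2 - 2 * N\<^sup>2 * (norm (A x))\<^sup>2 + (N\<^sup>2 * norm x)\<^sup>2"
      by (simp add: norm_diff_square rinner.scaleR_right)
    moreover have "(norm (A' (A x)))\<^sup>2 \<le> (N * norm (A x))\<^sup>2"
      by (intro power_mono A') auto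
    moreover have "(norm (A x))\<^sup>2 \<le> (N * norm x)\<^sup>2"
      by (intro power_mono A) auto
    then have "0 \<le> N\<^sup>2 * (N\<^sup>2 * (norm x)\<^sup>2 - (norm (A x))\<^sup>2)"
      by (simp add: power_mult_distrib)
    ultimately show ?thesis
      by (simp add: power_mult_distrib algebra_simps power2_eq_square)
  qed
  define s where "s = norm S + 1"
  have "s > 0" by (simp add: s_def add_nonneg_pos)
  \<comment> \<open>The inverse turns the estimate for \<open>?Q\<close> into this uniform gap
    between \<open>N\<^sup>2\<close> and the square of \<open>norm (A x)\<close> on unit vectors,
    contradicting \<open>N = norm A\<close>.\<close>
  define e where "e = 1 / (2 * N\<^sup>2 * s\<^sup>2)"
  have "e > 0" using \<open>s > 0\<close> \<open>N > 0\<close> by (simp add: e_def)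
  have key: "(norm (A x))\<^sup>2 \<le> (N\<^sup>2 - e) * (norm x)\<^sup>2" for x
  proof -
    have "norm x \<le> norm S * norm (?Q x)"
      using norm_blinfun[of S "?Q x"] by (simp only: S)
    also have "\<dots> \<le> s * norm (?Q x)"
      by (simp add: s_def mult_right_mono)
    finally have "(norm x)\<^sup>2 \<le> (s * norm (?Q x))\<^sup>2"
      by (simp add: power_mono)
    also have "\<dots> \<le> s\<^sup>2 * (2 * N\<^sup>2 * (N\<^sup>2 * (norm x)\<^sup>2 - (norm (A x))\<^sup>2))"
      using Q[of x] by (simp add: power_mult_distrib mult_left_mono)
    finally have "e * (norm x)\<^sup>2 \<le> N\<^sup>2 * (norm x)\<^sup>2 - (norm (A x))\<^sup>2"
      using \<open>s > 0\<close> \<open>N > 0\<close> by (simp add: e_def field_simps)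
    then show ?thesis by (simp add: algebra_simps)
  qed
  have "0 \<le> N\<^sup>2 - e"
  proof -
    obtain x where "A x \<noteq> 0" using assms(2) by (metis blinfun_eqI zero_blinfun.rep_eq)
    then have "x \<noteq> 0" by auto
    then show ?thesis using key[of x] zero_le_power2[of "norm (A x)"]
      by (smt (verit) mult_neg_pos zero_less_norm_iff zero_less_power)
  qed
  have "norm (A x) \<le> sqrt (N\<^sup>2 - e) * norm x" for x
    using real_sqrt_le_mono[OF key[of x]] by (simp add: real_sqrt_mult)
  then have "N \<le> sqrt (N\<^sup>2 - e)"
    unfolding N_def by (intro norm_blinfun_bound) (use \<open>0 \<le> N\<^sup>2 - e\<close> in \<open>auto simp: N_def\<close>)
  then have "N\<^sup>2 \<le> N\<^sup>2 - e"
    using \<open>0 \<le> N\<^sup>2 - e\<close> \<open>N > 0\<close> by (metis less_eq_real_def real_le_rsqrt real_sqrt_le_iff real_sqrt_unique)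
  with \<open>e > 0\<close> show False by simp
qed

text \<open>With \<open>A = p(T)\<close>, the operator \<open>A\<^sup>* A - (norm A)\<^sup>2\<close>
  is a polynomial in \<open>T\<close> and not invertible, so that polynomial vanishes at a spectral
  point. On the real line its first term is the squared modulus of \<open>p\<close>. The last
  assumption keeps the polynomial from being zero, as the factorisation requires.\<close>

lemma poly_op_norm_root:
  assumes sa: "selfadjoint_op T" and "poly_op p T \<noteq> 0"
    and "op_spectrum T \<subseteq> \<real>" "map_poly cnj p * p \<noteq> [:of_real ((norm (poly_op p T))\<^sup>2):]"
  obtains t where "complex_of_real t \<in> op_spectrum T" "cmod (poly p (of_real t)) = norm (poly_op p T)"
proof -
  let ?N2 = "of_real ((norm (poly_op p T))\<^sup>2) :: complex"
  let ?q = "map_poly cnj p * p - [:?N2:]"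
  note T = selfadjoint_opD(1)[OF sa]
  have "poly_op ?q T = (poly_op (map_poly cnj p) T o\<^sub>L poly_op p T) - ?N2 *\<^sub>C id_blinfun"
    by (simp add: poly_op_diff poly_op_mult[OF T])
  then have "\<not> invertible_op (poly_op ?q T)"
    using norm_square_in_spectrum[OF poly_op_adjoint[OF sa] assms(2)] by simp
  then obtain z where z: "z \<in> op_spectrum T" "poly ?q z = 0"
    using invertible_poly_op[OF T, of ?q] assms(4) by fastforce
  with assms(3) obtain t where t: "z = of_real t"
    by (auto elim: Reals_cases)
  have "of_real ((cmod (poly p z))\<^sup>2) = ?N2"
    using z(2) by (simp add: t complex_norm_square mult.commute del: of_real_power)
  then have "(cmod (poly p z))\<^sup>2 = (norm (poly_op p T))\<^sup>2"
    using of_real_eq_iff by blast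
  then have "cmod (poly p z) = norm (poly_op p T)"
    by simp
  with z t show ?thesis using that by blast
qed

text \<open>For \<open>p\<close> of degree one, \<open>map_poly cnj p * p\<close> has degree two and
  is not constant, so \<open>poly_op_norm_root\<close> applies once the shift \<open>k\<close> has
  made \<open>p(T)\<close> nonzero.\<close>

lemma op_spectrum_nonempty:
  fixes T :: "'a :: complex_inner \<Rightarrow>\<^sub>L 'a"
  assumes sa: "selfadjoint_op T" and "op_spectrum T \<subseteq> \<real>" and "x \<noteq> (0 :: 'a)"
  obtains t where "complex_of_real t \<in> op_spectrum T"
proof -
  note T = selfadjoint_opD(1)[OF sa]
  have "\<exists>k. T + k *\<^sub>C id_blinfun \<noteq> 0"
  proof (rule ccontr)
    assume "\<nexists>k. T + k *\<^sub>C id_blinfun \<noteq> 0"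
    then have "T + 0 *\<^sub>C id_blinfun = 0" "T + 1 *\<^sub>C id_blinfun = 0" by blast+
    then have "id_blinfun x = 0" by simp
    with assms(3) show False by simp
  qed
  then obtain k where k: "T + k *\<^sub>C id_blinfun \<noteq> 0" by blast
  have "poly_op [:k, 1:] T = T + k *\<^sub>C id_blinfun"
    by (simp add: poly_op_pCons[OF T])
  with k poly_op_norm_root[OF sa _ assms(2), of "[:k, 1:]"] that
  show ?thesis by (auto simp: map_poly_pCons)
qed

text \<open>Either the norm is attained by the modulus of \<open>p\<close> at a spectral point, or
  that modulus is constant on the real line and equal to the norm. In the second case some spectral
  point must exist for the bound \<open>M\<close> to apply.\<close>

lemma norm_poly_op_le:
  fixes T :: "'a :: complex_inner \<Rightarrow>\<^sub>L 'a"
  assumes sa: "selfadjoint_op T" and real: "op_spectrum T \<subseteq> \<real>" and "M \<ge> 0"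
    and M: "\<And>t. complex_of_real t \<in> op_spectrum T \<Longrightarrow> cmod (poly p (of_real t)) \<le> M"
  shows "norm (poly_op p T) \<le> M"
proof (cases "poly_op p T = 0")
  case False
  note T = selfadjoint_opD(1)[OF sa]
  then obtain x :: 'a where "x \<noteq> 0"
    using False by (metis blinfun.zero_right blinfun_eqI zero_blinfun.rep_eq)
  show ?thesis
  proof (cases "map_poly cnj p * p = [:of_real ((norm (poly_op p T))\<^sup>2):]")
    case True
    obtain t where t: "complex_of_real t \<in> op_spectrum T"
      using op_spectrum_nonempty[OF sa real \<open>x \<noteq> 0\<close>] by blast
    have "poly (map_poly cnj p * p) (of_real t) = of_real ((norm (poly_op p T))\<^sup>2)"
      by (simp add: True)
    then have "of_real ((cmod (poly p (of_real t)))\<^sup>2) = complex_of_real ((norm (poly_op p T))\<^sup>2)"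
      by (simp add: complex_norm_square mult.commute del: of_real_power)
    then have "(cmod (poly p (of_real t)))\<^sup>2 = (norm (poly_op p T))\<^sup>2"
      using of_real_eq_iff by blast
    then show ?thesis using M[OF t] by simp
  next
    case neq: False
    then show ?thesis
      using poly_op_norm_root[OF sa False real neq] M by metis
  qed
qed (use assms(3) in simp)

section \<open>Continuous functional calculus\<close>

lemma real_continuous_poly_approx:
  fixes g :: "real \<Rightarrow> real"
  assumes "continuous_on {a..b} g"
  obtains p :: "nat \<Rightarrow> complex poly" where
    "uniform_limit {a..b} (\<lambda>n t. poly (p n) (of_real t)) (\<lambda>t. complex_of_real (g t)) sequentially"
proof -
  have "\<exists>p. \<forall>t\<in>{a..b}. cmod (poly p (of_real t) - complex_of_real (g t)) < e" if e: "e > 0" for e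
  proof -
    obtain q where q: "real_polynomial_function q" "\<And>t. t \<in> {a..b} \<Longrightarrow> \<bar>g t - q t\<bar> < e"
      using Stone_Weierstrass_real_polynomial_function[OF compact_Icc assms e] by blast
    then obtain c n where c: "q = (\<lambda>x. \<Sum>i\<le>n. c i * x ^ i)"
      by (auto simp: real_polynomial_function_iff_sum)
    define p where "p = (\<Sum>i\<le>n. monom (complex_of_real (c i)) i)"
    have "poly p (of_real t) = of_real (q t)" for t
      by (simp add: p_def c poly_sum poly_monom)
    then have "cmod (poly p (of_real t) - of_real (g t)) = \<bar>q t - g t\<bar>" for t
      by (metis norm_of_real of_real_diff real_norm_def)
    with q(2) show ?thesis by (auto intro!: exI[of _ p] simp: abs_minus_commute)
  qed
  then have "\<exists>p. \<forall>t\<in>{a..b}. cmod (poly p (of_real t) - complex_of_real (g t)) < 1 / real (Suc n)" for n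
    by simp
  then obtain p where
    p: "\<And>n t. t \<in> {a..b} \<Longrightarrow> cmod (poly (p n) (of_real t) - complex_of_real (g t)) < 1 / real (Suc n)"
    by metis
  have "uniform_limit {a..b} (\<lambda>n t. poly (p n) (of_real t)) (\<lambda>t. complex_of_real (g t)) sequentially"
  proof (rule uniform_limitI)
    fix e :: real assume "e > 0"
    then have "\<forall>\<^sub>F n in sequentially. 1 / real (Suc n) < e"
      using LIMSEQ_Suc[OF lim_1_over_n] by (auto dest: order_tendstoD(2))
    then show "\<forall>\<^sub>F n in sequentially. \<forall>t\<in>{a..b}. dist (poly (p n) (of_real t)) (complex_of_real (g t)) < e"
      by eventually_elim (use p in \<open>force simp: dist_norm intro: less_trans\<close>)
  qed
  with that show ?thesis by blast
qed

lemma norm_poly_op_diff_le: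
  assumes "selfadjoint_op T" and "op_spectrum T \<subseteq> \<real>" and "e \<ge> 0"
    and "\<And>t. complex_of_real t \<in> op_spectrum T \<Longrightarrow> dist (poly p (of_real t)) (poly q (of_real t)) \<le> e"
  shows "norm (poly_op p T - poly_op q T) \<le> e"
  using norm_poly_op_le[OF assms(1-3), of "p - q"] assms(4) by (simp add: poly_op_diff dist_norm)

text \<open>By \<open>norm_poly_op_le\<close>, any two approximating sequences of polynomials have
  the same limit, so the description in \<open>cfc\<close> has a solution; the given
  \<open>q\<close> makes it unique, as without an approximating sequence every operator would
  qualify.\<close>

lemma cfc_limit:
  fixes T :: "'a :: chilbert_space \<Rightarrow>\<^sub>L 'a"
  assumes sa: "selfadjoint_op T" and spec: "op_spectrum T \<subseteq> \<real>"
    and q: "uniform_limit {t. complex_of_real t \<in> op_spectrum T}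
      (\<lambda>n t. poly (q n) (complex_of_real t)) g sequentially"
  shows "(\<lambda>n. poly_op (q n) T) \<longlonglongrightarrow> cfc g T"
proof -
  let ?X = "{t. complex_of_real t \<in> op_spectrum T}"
  have close: "\<exists>N. \<forall>n\<ge>N. \<forall>m\<ge>N. norm (poly_op (p n) T - poly_op (q m) T) < e"
    if p: "uniform_limit ?X (\<lambda>n t. poly (p n) (complex_of_real t)) g sequentially" and "e > 0" for p e
  proof -
    have "\<forall>\<^sub>F n in sequentially. (\<forall>t\<in>?X. dist (poly (p n) (of_real t)) (g t) < e / 4)
        \<and> (\<forall>t\<in>?X. dist (poly (q n) (of_real t)) (g t) < e / 4)"
      using uniform_limitD[OF p, of "e / 4"] uniform_limitD[OF q, of "e / 4"] \<open>e > 0\<close>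
      by (auto intro: eventually_conj)
    then obtain N where N: "\<And>n t. n \<ge> N \<Longrightarrow> t \<in> ?X \<Longrightarrow> dist (poly (p n) (of_real t)) (g t) < e / 4"
        "\<And>n t. n \<ge> N \<Longrightarrow> t \<in> ?X \<Longrightarrow> dist (poly (q n) (of_real t)) (g t) < e / 4"
      by (auto simp: eventually_sequentially)
    have "norm (poly_op (p n) T - poly_op (q m) T) \<le> e / 2" if "n \<ge> N" "m \<ge> N" for n m
    proof (rule norm_poly_op_diff_le[OF sa spec])
      fix t assume "complex_of_real t \<in> op_spectrum T"
      then have t: "t \<in> ?X" by simp
      show "dist (poly (p n) (of_real t)) (poly (q m) (of_real t)) \<le> e / 2"
        using dist_triangle2[of "poly (p n) (of_real t)" "poly (q m) (of_real t)" "g t"]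
          N(1)[OF that(1) t] N(2)[OF that(2) t] by simp
    qed (use \<open>e > 0\<close> in simp)
    then show ?thesis using \<open>e > 0\<close> by (intro exI[of _ N]) (force intro: le_less_trans)
  qed
  have "Cauchy (\<lambda>n. poly_op (q n) T)"
    using close[OF q] by (auto simp: Cauchy_def dist_norm)
  then obtain S where S: "(\<lambda>n. poly_op (q n) T) \<longlonglongrightarrow> S"
    using Cauchy_convergent_iff convergent_def by blast
  have "(\<lambda>n. poly_op (p n) T) \<longlonglongrightarrow> S"
    if p: "uniform_limit ?X (\<lambda>n t. poly (p n) (complex_of_real t)) g sequentially" for p
  proof -
    have "(\<lambda>n. poly_op (p n) T - poly_op (q n) T) \<longlonglongrightarrow> 0"
      unfolding LIMSEQ_iff using close[OF p] by fastforce
    from tendsto_add[OF this S] show ?thesis by simp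
  qed
  then have "cfc g T = S"
    unfolding cfc_def using q by (intro the_equality) (auto intro: LIMSEQ_unique)
  with S show ?thesis by simp
qed

text \<open>The spectrum is only required to lie in the interval, so that one class of continuous
  functions serves both \<open>H\<close> and \<open>\<phi> H\<close>, whose spectra may
  differ.\<close>

locale selfadjoint_calculus =
  fixes T :: "'a :: chilbert_space \<Rightarrow>\<^sub>L 'a" and a b :: real
  assumes selfadjoint: "selfadjoint_op T"
    and spectrum: "op_spectrum T \<subseteq> complex_of_real ` {a..b}"
begin

definition fc :: "(real \<Rightarrow> real) \<Rightarrow> 'a \<Rightarrow>\<^sub>L 'a" where
  "fc g = cfc (\<lambda>t. complex_of_real (g t)) T"

lemma T_in_bounded_ops: "T \<in> bounded_ops"
  by (rule selfadjoint_opD(1)[OF selfadjoint])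

lemma spectrum_real: "op_spectrum T \<subseteq> \<real>"
  using spectrum by auto

lemma spectrum_Icc: "{t. complex_of_real t \<in> op_spectrum T} \<subseteq> {a..b}"
  using spectrum by fastforce

lemma fc_limit:
  assumes "uniform_limit {a..b} (\<lambda>n t. poly (p n) (of_real t)) (\<lambda>t. complex_of_real (g t)) sequentially"
  shows "(\<lambda>n. poly_op (p n) T) \<longlonglongrightarrow> fc g"
  unfolding fc_def
  by (intro cfc_limit selfadjoint spectrum_real uniform_limit_on_subset[OF assms spectrum_Icc])

lemma fc_cong:
  assumes "continuous_on {a..b} g" and "\<And>t. t \<in> {a..b} \<Longrightarrow> g t = h t"
  shows "fc g = fc h"
proof -
  obtain p :: "nat \<Rightarrow> complex poly" where
    p: "uniform_limit {a..b} (\<lambda>n t. poly (p n) (of_real t)) (\<lambda>t. complex_of_real (g t)) sequentially"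
    using real_continuous_poly_approx[OF assms(1)] by blast
  have "uniform_limit {a..b} (\<lambda>n t. poly (p n) (of_real t)) (\<lambda>t. complex_of_real (h t)) sequentially"
    using p by (rule uniform_limit_cong'[THEN iffD1, rotated 2]) (use assms in auto)
  with fc_limit p show ?thesis by (blast intro: LIMSEQ_unique)
qed

lemma fc_add:
  assumes "continuous_on {a..b} g" "continuous_on {a..b} h"
  shows "fc (\<lambda>t. g t + h t) = fc g + fc h"
proof -
  obtain p :: "nat \<Rightarrow> complex poly" where
    p: "uniform_limit {a..b} (\<lambda>n t. poly (p n) (of_real t)) (\<lambda>t. complex_of_real (g t)) sequentially"
    using real_continuous_poly_approx[OF assms(1)] by blast
  obtain q :: "nat \<Rightarrow> complex poly" where
    q: "uniform_limit {a..b} (\<lambda>n t. poly (q n) (of_real t)) (\<lambda>t. complex_of_real (h t)) sequentially"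
    using real_continuous_poly_approx[OF assms(2)] by blast
  have "(\<lambda>n. poly_op (p n + q n) T) \<longlonglongrightarrow> fc (\<lambda>t. g t + h t)"
    using uniform_limit_add[OF p q] by (intro fc_limit) simp
  moreover have "(\<lambda>n. poly_op (p n + q n) T) \<longlonglongrightarrow> fc g + fc h"
    unfolding poly_op_add by (intro tendsto_add fc_limit p q)
  ultimately show ?thesis by (rule LIMSEQ_unique)
qed

lemma fc_mult:
  assumes "continuous_on {a..b} g" "continuous_on {a..b} h"
  shows "fc (\<lambda>t. g t * h t) = fc g o\<^sub>L fc h"
proof -
  obtain p :: "nat \<Rightarrow> complex poly" where
    p: "uniform_limit {a..b} (\<lambda>n t. poly (p n) (of_real t)) (\<lambda>t. complex_of_real (g t)) sequentially"
    using real_continuous_poly_approx[OF assms(1)] by blast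
  obtain q :: "nat \<Rightarrow> complex poly" where
    q: "uniform_limit {a..b} (\<lambda>n t. poly (q n) (of_real t)) (\<lambda>t. complex_of_real (h t)) sequentially"
    using real_continuous_poly_approx[OF assms(2)] by blast
  have bdd: "bounded ((\<lambda>t. complex_of_real (k t)) ` {a..b})" if "continuous_on {a..b} k" for k
    using that by (intro compact_imp_bounded compact_continuous_image continuous_intros) auto
  have "(\<lambda>n. poly_op (p n * q n) T) \<longlonglongrightarrow> fc (\<lambda>t. g t * h t)"
    using uniform_lim_mult[OF p q bdd bdd] assms by (intro fc_limit) simp
  moreover have "(\<lambda>n. poly_op (p n * q n) T) \<longlonglongrightarrow> (fc g o\<^sub>L fc h)"
    unfolding poly_op_mult[OF T_in_bounded_ops]
    by (intro bounded_bilinear.tendsto[OF bounded_bilinear_blinfun_compose] fc_limit p q)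
  ultimately show ?thesis by (rule LIMSEQ_unique)
qed

lemma fc_const: "fc (\<lambda>t. c) = c *\<^sub>R id_blinfun"
proof -
  have "(\<lambda>n. poly_op [:complex_of_real c:] T) \<longlonglongrightarrow> fc (\<lambda>t. c)"
    by (rule fc_limit) (simp add: uniform_limit_const)
  then show ?thesis
    by (simp add: LIMSEQ_const_iff scaleR_scaleC)
qed

lemma fc_id: "fc (\<lambda>t. t) = T"
proof -
  have "(\<lambda>n. poly_op [:0, 1:] T) \<longlonglongrightarrow> fc (\<lambda>t. t)"
    by (rule fc_limit) (simp add: uniform_limit_const)
  then show ?thesis
    by (simp add: LIMSEQ_const_iff T_in_bounded_ops)
qed

lemma fc_scaleR: "continuous_on {a..b} g \<Longrightarrow> fc (\<lambda>t. c * g t) = c *\<^sub>R fc g"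
  using fc_mult[of "\<lambda>t. c" g] by (auto simp: fc_const scaleR_blinfun.rep_eq intro!: blinfun_eqI)

lemma fc_diff:
  assumes "continuous_on {a..b} g" "continuous_on {a..b} h"
  shows "fc (\<lambda>t. g t - h t) = fc g - fc h"
  using fc_add[OF assms(1), of "\<lambda>t. - 1 * h t"] fc_scaleR[OF assms(2), of "- 1"] assms(2)
  by (simp add: continuous_on_minus)

lemma fc_sum:
  assumes "\<And>i. i \<in> I \<Longrightarrow> continuous_on {a..b} (g i)"
  shows "fc (\<lambda>t. \<Sum>i\<in>I. g i t) = (\<Sum>i\<in>I. fc (g i))"
  using assms
  by (induction I rule: infinite_finite_induct) (simp_all add: fc_const fc_add continuous_on_sum)

lemma selfadjoint_fc:
  assumes "continuous_on {a..b} g"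
  shows "selfadjoint_op (fc g)"
proof -
  obtain p :: "nat \<Rightarrow> complex poly" where
    p: "uniform_limit {a..b} (\<lambda>n t. poly (p n) (of_real t)) (\<lambda>t. complex_of_real (g t)) sequentially"
    using real_continuous_poly_approx[OF assms] by blast
  \<comment> \<open>As \<open>g\<close> is real, the conjugated polynomials, which represent the
    adjoints, approximate it as well.\<close>
  have p': "uniform_limit {a..b} (\<lambda>n t. poly (map_poly cnj (p n)) (of_real t))
      (\<lambda>t. complex_of_real (g t)) sequentially"
    using bounded_linear.uniform_limit[OF bounded_linear_cnj p] by simp
  show ?thesis
  proof (rule selfadjoint_opI)
    show "fc g \<in> bounded_ops"
      by (rule bounded_ops_limit[OF _ fc_limit[OF p]]) (simp add: T_in_bounded_ops)
    fix x y
    have "(\<lambda>n. rinner (poly_op (p n) T x) y) \<longlonglongrightarrow> rinner (fc g x) y"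
      by (intro rinner.tendsto blinfun.tendsto fc_limit p tendsto_const)
    moreover have "(\<lambda>n. rinner x (poly_op (map_poly cnj (p n)) T y)) \<longlonglongrightarrow> rinner x (fc g y)"
      by (intro rinner.tendsto blinfun.tendsto fc_limit p' tendsto_const)
    ultimately show "rinner (fc g x) y = rinner x (fc g y)"
      by (simp add: rinner_def poly_op_adjoint[OF selfadjoint] LIMSEQ_unique)
  qed
qed

lemma norm_fc_le:
  assumes "continuous_on {a..b} g" and "\<And>t. t \<in> {a..b} \<Longrightarrow> \<bar>g t\<bar> \<le> M" and "M \<ge> 0"
  shows "norm (fc g) \<le> M"
proof (rule field_le_epsilon)
  fix e :: real assume "e > 0"
  obtain p :: "nat \<Rightarrow> complex poly" where
    p: "uniform_limit {a..b} (\<lambda>n t. poly (p n) (of_real t)) (\<lambda>t. complex_of_real (g t)) sequentially"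
    using real_continuous_poly_approx[OF assms(1)] by blast
  have "\<forall>\<^sub>F n in sequentially. norm (poly_op (p n) T) \<le> M + e"
    using uniform_limitD[OF p \<open>e > 0\<close>]
  proof eventually_elim
    case (elim n)
    show ?case
    proof (rule norm_poly_op_le[OF selfadjoint spectrum_real])
      fix t assume "complex_of_real t \<in> op_spectrum T"
      then have t: "t \<in> {a..b}" using spectrum_Icc by blast
      have "cmod (poly (p n) (of_real t)) \<le> cmod (of_real (g t)) + dist (poly (p n) (of_real t)) (of_real (g t))"
        by (metis add.commute dist_norm norm_triangle_sub)
      also have "\<dots> \<le> M + e"
        using assms(2)[OF t] elim t by (intro add_mono) (auto intro: less_imp_le)
      finally show "cmod (poly (p n) (of_real t)) \<le> M + e" .
    qed (use assms \<open>e > 0\<close> in simp)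
  qed
  then show "norm (fc g) \<le> M + e"
    using tendsto_upperbound[OF tendsto_norm[OF fc_limit[OF p]]] by simp
qed

text \<open>If \<open>0 \<le> g \<le> M\<close>, then \<open>M - g\<close> is bounded by
  \<open>M\<close> in modulus. Hence \<open>M - g(T)\<close> has norm at most \<open>M\<close>, and
  Cauchy-Schwarz leaves a nonnegative form for \<open>g(T)\<close>.\<close>

lemma fc_nonneg:
  assumes "continuous_on {a..b} g" and "\<And>t. t \<in> {a..b} \<Longrightarrow> 0 \<le> g t"
  shows "0 \<le> rinner x (fc g x)"
proof -
  have "bounded (g ` {a..b})"
    using assms(1) by (intro compact_imp_bounded compact_continuous_image) auto
  then obtain M where M: "\<And>t. t \<in> {a..b} \<Longrightarrow> \<bar>g t\<bar> \<le> M" "M > 0"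
    by (force simp: bounded_pos)
  have "norm (fc (\<lambda>t. M - g t)) \<le> M"
    using assms M by (intro norm_fc_le continuous_intros) force+
  moreover have "fc (\<lambda>t. M - g t) = M *\<^sub>R id_blinfun - fc g"
    by (simp add: fc_diff[OF _ assms(1)] fc_const)
  ultimately have "norm (M *\<^sub>R x - fc g x) \<le> M * norm x"
    using norm_blinfun[of "M *\<^sub>R id_blinfun - fc g" x] mult_right_mono[of "norm (M *\<^sub>R id_blinfun - fc g)" M "norm x"]
    by (simp add: minus_blinfun.rep_eq scaleR_blinfun.rep_eq)
  then have "rinner x (M *\<^sub>R x - fc g x) \<le> M * norm x * norm x"
    by (smt (verit, best) mult.commute mult_left_mono norm_ge_zero rinner_le_norm)
  then show ?thesis
    by (simp add: rinner.diff_right rinner.scaleR_right rinner_self power2_eq_square)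
qed

lemma fc_mono:
  assumes "continuous_on {a..b} g" "continuous_on {a..b} h"
    and "\<And>t. t \<in> {a..b} \<Longrightarrow> g t \<le> h t"
  shows "rinner x (fc g x) \<le> rinner x (fc h x)"
  using fc_nonneg[of "\<lambda>t. h t - g t" x] assms
  by (simp add: fc_diff minus_blinfun.rep_eq rinner.diff_right continuous_on_diff)

lemma norm_fc_square:
  assumes "continuous_on {a..b} g"
  shows "(norm (fc g x))\<^sup>2 = rinner x (fc (\<lambda>t. (g t)\<^sup>2) x)"
  using fc_mult[OF assms assms] selfadjoint_opD(3)[OF selfadjoint_fc[OF assms], of x "fc g x"]
  by (simp add: rinner_self power2_eq_square)

end

section \<open>Convex functions on an interval\<close>

lemma strictly_convex_on_imp_convex_on:
  assumes "strictly_convex_on S f"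
  shows "convex_on S f"
proof (rule convex_onI)
  show "convex S" using assms by (simp add: strictly_convex_on_def)
  fix t x y :: real assume "0 < t" "t < 1" "x \<in> S" "y \<in> S"
  then show "f ((1 - t) *\<^sub>R x + t *\<^sub>R y) \<le> (1 - t) * f x + t * f y"
    using assms by (cases "x = y")
      (auto simp: strictly_convex_on_def less_imp_le simp flip: scaleR_left_distrib distrib_right)
qed

text \<open>Endpoints are excluded because the slope may be infinite there, in which case no affine
  minorant touches the graph.\<close>

lemma subgradient_exists:
  assumes "convex_on {a..b} f" "a < p" "p < b"
  obtains m :: real where "\<And>t. t \<in> {a..b} \<Longrightarrow> f p + m * (t - p) \<le> f t"
  using convex_le_Inf_differential[OF assms(1), of p] assms(2,3) by auto

text \<open>Compactness makes strictness uniform: the midpoint defect is continuous and positive on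
  the compact set of pairs at distance at least \<open>d\<close>.\<close>

lemma strictly_convex_on_gap:
  assumes cont: "continuous_on {a..b} f" and strict: "strictly_convex_on {a..b} f" and "d > 0"
  obtains \<kappa> :: real where "\<kappa> > 0"
    and "\<And>x y. x \<in> {a..b} \<Longrightarrow> y \<in> {a..b} \<Longrightarrow> d \<le> \<bar>x - y\<bar> \<Longrightarrow> \<kappa> \<le> f x + f y - 2 * f ((x + y) / 2)"
proof -
  define K where "K = ({a..b} \<times> {a..b}) \<inter> {z. d \<le> \<bar>fst z - snd z\<bar>}"
  define F where "F z = f (fst z) + f (snd z) - 2 * f ((fst z + snd z) / 2)" for z
  have "closed {z :: real \<times> real. d \<le> \<bar>fst z - snd z\<bar>}"
    by (intro closed_Collect_le continuous_intros)
  then have "compact K"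
    unfolding K_def by (intro compact_Int_closed compact_Times) auto
  have "continuous_on K F"
    unfolding F_def
    by (intro continuous_intros continuous_on_compose2[OF cont]) (auto simp: K_def)
  have pos: "F z > 0" if "z \<in> K" for z
  proof -
    have z: "fst z \<in> {a..b}" "snd z \<in> {a..b}" "fst z \<noteq> snd z"
      using that \<open>d > 0\<close> by (auto simp: K_def)
    have "0 < (1/2 :: real)" "(1/2 :: real) < 1" by simp_all
    with strict z have "f ((1 - 1/2) * fst z + 1/2 * snd z) < (1 - 1/2) * f (fst z) + 1/2 * f (snd z)"
      unfolding strictly_convex_on_def by blast
    then show ?thesis by (simp add: F_def add_divide_distrib)
  qed
  obtain \<kappa> where "\<kappa> > 0" "\<And>z. z \<in> K \<Longrightarrow> \<kappa> \<le> F z"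
  proof (cases "K = {}")
    case True
    \<comment> \<open>No two points are that far apart, so any positive value serves.\<close>
    then show ?thesis using that[of 1] by simp
  next
    case False
    then obtain z where "z \<in> K" "\<And>y. y \<in> K \<Longrightarrow> F z \<le> F y"
      using continuous_attains_inf[OF \<open>compact K\<close> _ \<open>continuous_on K F\<close>] by blast
    then show ?thesis using that[of "F z"] pos by blast
  qed
  then show ?thesis
    using that[of \<kappa>] by (force simp: K_def F_def)
qed

text \<open>Inserting the tangent bound at the midpoint of \<open>p\<close> and \<open>t\<close>
  into the midpoint gap leaves exactly the excess of \<open>f t\<close> over the tangent. It matters
  that \<open>\<kappa>\<close> is independent of \<open>p\<close> and of the slope \<open>m\<close>,
  which may be arbitrarily steep.\<close>

lemma strictly_convex_on_tangent_gap:
  assumes cont: "continuous_on {a..b} f" and strict: "strictly_convex_on {a..b} f" and "d > 0"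
  obtains \<kappa> :: real where "\<kappa> > 0"
    and "\<And>p m t. (\<And>s. s \<in> {a..b} \<Longrightarrow> f p + m * (s - p) \<le> f s) \<Longrightarrow> p \<in> {a..b} \<Longrightarrow> t \<in> {a..b} \<Longrightarrow>
      d \<le> \<bar>t - p\<bar> \<Longrightarrow> \<kappa> \<le> f t - f p - m * (t - p)"
proof -
  obtain \<kappa> where \<kappa>: "\<kappa> > 0"
    "\<And>x y. x \<in> {a..b} \<Longrightarrow> y \<in> {a..b} \<Longrightarrow> d \<le> \<bar>x - y\<bar> \<Longrightarrow> \<kappa> \<le> f x + f y - 2 * f ((x + y) / 2)"
    using strictly_convex_on_gap[OF assms] by blast
  have "\<kappa> \<le> f t - f p - m * (t - p)"
    if sub: "\<And>s. s \<in> {a..b} \<Longrightarrow> f p + m * (s - p) \<le> f s" and "p \<in> {a..b}" "t \<in> {a..b}" "d \<le> \<bar>t - p\<bar>"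
    for p m t
  proof -
    have "f p + m * ((t + p) / 2 - p) \<le> f ((t + p) / 2)"
      using that by (intro sub) auto
    moreover have "\<kappa> \<le> f t + f p - 2 * f ((t + p) / 2)"
      using that by (intro \<kappa>) auto
    moreover have "2 * (m * ((t + p) / 2 - p)) = m * (t - p)"
      by (simp add: field_simps)
    ultimately show ?thesis by linarith
  qed
  with \<kappa>(1) that show ?thesis by blast
qed

section \<open>Partitions of unity adapted to tangents\<close>

text \<open>On a uniform mesh, the distance of \<open>f\<close> to its tangent at a node is bounded on the two adjacent
  cells by the second difference of \<open>f\<close>; the second differences telescope, so their sum tends to
  \<open>0\<close> by uniform continuity, even if the slopes of \<open>f\<close> are unbounded.\<close>

lemma tangent_partition_of_unity:
  fixes f :: "real \<Rightarrow> real"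
  assumes cont: "continuous_on {a..b} f" and conv: "convex_on {a..b} f"
    and "a < b" and "e > 0" and "d > 0"
  obtains h :: "nat \<Rightarrow> real \<Rightarrow> real" and N :: nat and p m B :: "nat \<Rightarrow> real" where
    "\<forall>k. continuous_on {a..b} (h k)" "\<forall>k t. 0 \<le> h k t" "\<forall>t. (\<Sum>k<N. h k t) = 1"
    "\<forall>k<N. p k \<in> {a..b}"
    "\<forall>k<N. \<forall>t\<in>{a..b}. f (p k) + m k * (t - p k) \<le> f t"
    "\<forall>k<N. \<forall>t\<in>{a..b}. h k t \<noteq> 0 \<longrightarrow> \<bar>t - p k\<bar> \<le> d \<and> f t - f (p k) - m k * (t - p k) \<le> B k"
    "\<forall>k<N. 0 \<le> B k" "(\<Sum>k<N. B k) \<le> e"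
proof -
  have "uniformly_continuous_on {a..b} f"
    by (rule compact_uniformly_continuous[OF cont compact_Icc])
  then obtain d' where d': "d' > 0"
    "\<And>x y. x \<in> {a..b} \<Longrightarrow> y \<in> {a..b} \<Longrightarrow> \<bar>y - x\<bar> < d' \<Longrightarrow> \<bar>f y - f x\<bar> < e / 2"
    using half_gt_zero[OF \<open>e > 0\<close>] unfolding uniformly_continuous_on_def dist_real_def by meson
  obtain n :: nat where n: "(b - a) / min d d' < real n"
    using reals_Archimedean2 by blast
  \<comment> \<open>\<open>N\<close> must be positive for \<open>cut 0 = 1\<close> and
    \<open>cut N = 0\<close> to be compatible. The mesh has \<open>Suc N\<close> cells and thus
    \<open>N\<close> interior nodes, where tangents exist.\<close>
  define N where "N = Suc n"
  define \<delta> where "\<delta> = (b - a) / real (Suc N)"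
  have "\<delta> > 0" using \<open>a < b\<close> by (simp add: \<delta>_def)
  have "b - a < real n * min d d'"
    using n \<open>d > 0\<close> \<open>d' > 0\<close> by (simp add: pos_divide_less_eq)
  also have "\<dots> \<le> real (Suc N) * min d d'"
    using \<open>d > 0\<close> \<open>d' > 0\<close> by (intro mult_right_mono) (auto simp: N_def)
  finally have "\<delta> < min d d'"
    unfolding \<delta>_def by (subst pos_divide_less_eq) (simp_all only: mult.commute of_nat_0_less_iff zero_less_Suc)
  define s where "s k = a + real k * \<delta>" for k
  have s0: "s 0 = a" and sN: "s (Suc N) = b"
    by (auto simp: s_def \<delta>_def)
  have s_Suc: "s (Suc k) = s k + \<delta>" for k
    by (simp add: s_def algebra_simps)
  have s_mono: "s j \<le> s k" if "j \<le> k" for j k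
    using that \<open>\<delta> > 0\<close> by (simp add: s_def)
  have s_strict: "s j < s k" if "j < k" for j k
    using that \<open>\<delta> > 0\<close> by (simp add: s_def)
  have s_in: "s k \<in> {a..b}" if "k \<le> Suc N" for k
    using s_mono[of 0 k] s_mono[OF that] s0 sN by simp
  \<comment> \<open>For interior indices a ramp from 0 to 1 over the cell that starts at
    \<open>s k\<close>. The constants at the two ends make the differences sum to 1 at every
    \<open>t\<close> and spare a tangent at \<open>a\<close> or \<open>b\<close>.\<close>
  define cut where "cut k t = (if k = 0 then 1 else if N \<le> k then 0 else min 1 (max 0 ((t - s k) / \<delta>)))"
    for k :: nat and t
  define h where "h k t = cut k t - cut (Suc k) t" for k t
  have cut_mono: "cut (Suc k) t \<le> cut k t" for k t
  proof -
    have "(t - s (Suc k)) / \<delta> \<le> (t - s k) / \<delta>"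
      using s_mono[of k "Suc k"] \<open>\<delta> > 0\<close> by (intro divide_right_mono) auto
    then show ?thesis by (auto simp: cut_def)
  qed
  have cut_one: "cut k t = 1" if "k < N" "s (Suc k) \<le> t" for k t
    using that \<open>\<delta> > 0\<close> by (simp add: cut_def s_Suc)
  have cut_zero: "cut k t = 0" if "k \<noteq> 0" "t \<le> s k" for k t
    using that \<open>\<delta> > 0\<close> by (simp add: cut_def divide_nonpos_pos)
  have supp: "s k \<le> t \<and> t \<le> s (Suc (Suc k))" if "k < N" "t \<in> {a..b}" "h k t \<noteq> 0" for k t
  proof (rule ccontr)
    assume "\<not> (s k \<le> t \<and> t \<le> s (Suc (Suc k)))"
    then consider "t < s k" | "s (Suc (Suc k)) < t" by linarith
    then show False
    proof cases
      case 1
      then have "k \<noteq> 0" using s0 that(2) by (metis atLeastAtMost_iff not_less)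
      then show False
        using cut_zero[of k t] cut_zero[of "Suc k" t] 1 s_mono[of k "Suc k"] that(3) by (simp add: h_def)
    next
      case 2
      \<comment> \<open>For \<open>Suc k = N\<close> the right end of the support is
        \<open>b\<close>, which \<open>t\<close> cannot exceed.\<close>
      then have "Suc k < N"
        using s_mono[of "Suc N" "Suc (Suc k)"] sN that(1,2) by (metis atLeastAtMost_iff not_less
            Suc_lessI less_le_trans order.refl less_irrefl)
      then show False
        using cut_one[of k t] cut_one[of "Suc k" t] 2 s_mono[of "Suc k" "Suc (Suc k)"] that(3)
        by (simp add: h_def)
    qed
  qed
  define p where "p k = s (Suc k)" for k
  define B where "B k = f (s k) + f (s (Suc (Suc k))) - 2 * f (s (Suc k))" for k
  have "\<exists>m. \<forall>t\<in>{a..b}. f (p k) + m * (t - p k) \<le> f t" if "k < N" for k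
    using subgradient_exists[OF conv, of "p k"] s_strict[of 0 "Suc k"] s_strict[of "Suc k" "Suc N"]
      that s0 sN unfolding p_def by (metis Suc_mono zero_less_Suc)
  then obtain m where sub: "\<And>k t. k < N \<Longrightarrow> t \<in> {a..b} \<Longrightarrow> f (p k) + m k * (t - p k) \<le> f t"
    by metis
  \<comment> \<open>A second difference does not see the affine tangent, so \<open>B k\<close> is
    the sum of the tangent errors at both ends of the support.\<close>
  have B_eq: "B k = (f (s k) - f (p k) - m k * (s k - p k))
      + (f (s (Suc (Suc k))) - f (p k) - m k * (s (Suc (Suc k)) - p k))" for k
    by (simp add: B_def p_def s_Suc algebra_simps)
  have ends: "0 \<le> f (s k) - f (p k) - m k * (s k - p k)"
    "0 \<le> f (s (Suc (Suc k))) - f (p k) - m k * (s (Suc (Suc k)) - p k)" if "k < N" for k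
    using sub[OF that s_in[of k]] sub[OF that s_in[of "Suc (Suc k)"]] that by auto
  have B_bound: "f t - f (p k) - m k * (t - p k) \<le> B k"
    if k: "k < N" and t: "s k \<le> t" "t \<le> s (Suc (Suc k))" for k t
  proof -
    define \<theta> where "\<theta> = (t - s k) / (2 * \<delta>)"
    have \<theta>: "0 \<le> \<theta>" "\<theta> \<le> 1"
      using t \<open>\<delta> > 0\<close> by (auto simp: \<theta>_def s_Suc)
    have t_eq: "t = (1 - \<theta>) * s k + \<theta> * s (Suc (Suc k))"
      using \<open>\<delta> > 0\<close> by (simp add: \<theta>_def s_Suc field_simps)
    have "f t \<le> (1 - \<theta>) * f (s k) + \<theta> * f (s (Suc (Suc k)))"
      using convex_onD[OF conv \<theta> s_in[of k] s_in[of "Suc (Suc k)"]] k t_eq by simp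
    \<comment> \<open>The tangent error is convex, hence below the chord of its two end
      values.\<close>
    then have "f t - f (p k) - m k * (t - p k) \<le>
        (1 - \<theta>) * (f (s k) - f (p k) - m k * (s k - p k))
        + \<theta> * (f (s (Suc (Suc k))) - f (p k) - m k * (s (Suc (Suc k)) - p k))"
      by (subst t_eq) (simp add: algebra_simps)
    also have "\<dots> \<le> B k"
      unfolding B_eq using ends[OF k] \<theta> by (intro add_mono mult_left_le_one_le) auto
    finally show ?thesis .
  qed
  have sumB: "(\<Sum>k<j. B k) = (f (s (Suc j)) - f (s j)) - (f (s 1) - f (s 0))" for j
    by (induction j) (simp_all add: B_def)
  have r1: "continuous_on {a..b} (h k)" for k
  proof -
    have "continuous_on {a..b} (cut j)" for j
      using \<open>\<delta> > 0\<close> by (cases "j = 0"; cases "N \<le> j") (auto simp: cut_def intro!: continuous_intros)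
    then show ?thesis
      unfolding h_def by (intro continuous_on_diff) auto
  qed
  have r2: "0 \<le> h k t" for k t
    using cut_mono by (simp add: h_def)
  have r3: "(\<Sum>k<N. h k t) = 1" for t
  proof -
    have "cut 0 t = 1" "cut N t = 0" by (simp_all add: cut_def N_def)
    then show ?thesis
      using sum_lessThan_telescope'[of "\<lambda>k. cut k t" N] by (simp only: h_def)
  qed
  have r4: "p k \<in> {a..b}" if "k < N" for k
    using that s_in[of "Suc k"] by (simp add: p_def)
  have r5: "\<bar>t - p k\<bar> \<le> d" if "k < N" "t \<in> {a..b}" "h k t \<noteq> 0" for k t
    using supp[OF that] \<open>\<delta> < min d d'\<close> by (auto simp: p_def s_Suc)
  have r6: "f t - f (p k) - m k * (t - p k) \<le> B k" if "k < N" "t \<in> {a..b}" "h k t \<noteq> 0" for k t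
    using supp[OF that] B_bound[OF that(1)] by blast
  have r7: "0 \<le> B k" if "k < N" for k
    unfolding B_eq using ends[OF that] by simp
  have r8: "f (p k) + m k * (t - p k) \<le> f t" if "k < N" "t \<in> {a..b}" for k t
    using sub that by blast
  have "\<bar>f (s (Suc k)) - f (s k)\<bar> < e / 2" if "k \<le> N" for k
    using that \<open>\<delta> < min d d'\<close> \<open>\<delta> > 0\<close> by (intro d'(2) s_in) (auto simp: s_Suc)
  from this[of N] this[of 0] have "\<bar>f (s (Suc N)) - f (s N)\<bar> < e / 2" "\<bar>f (s 1) - f (s 0)\<bar> < e / 2"
    by simp_all
  then have r9: "(\<Sum>k<N. B k) \<le> e"
    unfolding sumB by linarith
  show ?thesis
    by (rule that[of h N p m B]) (use r1 r2 r3 r4 r5 r6 r7 r8 r9 in blast)+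
qed

text \<open>Cells away from \<open>c\<close> use tangents there, whose distance to \<open>f\<close> on the other side of \<open>c\<close> is
  bounded below; the cells near \<open>c\<close> are merged into one, which uses the tangent at \<open>c\<close>.\<close>

lemma hinge_partition_of_unity:
  fixes f :: "real \<Rightarrow> real"
  assumes cont: "continuous_on {a..b} f" and strict: "strictly_convex_on {a..b} f"
    and c: "a < c" "c < b" and "e > 0"
  obtains h :: "nat \<Rightarrow> real \<Rightarrow> real" and I :: "nat set" and w A :: "nat \<Rightarrow> real \<Rightarrow> real"
    and \<beta> :: "nat \<Rightarrow> real" where
    "finite I" "\<forall>i. continuous_on {a..b} (h i)" "\<forall>i t. 0 \<le> h i t" "\<forall>t. (\<Sum>i\<in>I. h i t) = 1"
    "\<forall>i. w i = (\<lambda>t. max (t - c) 0) \<or> w i = (\<lambda>t. max (c - t) 0)"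
    "\<forall>i. \<exists>\<alpha> \<gamma> C. A i = (\<lambda>t. \<alpha> + \<gamma> * t + C * f t)"
    "\<forall>i\<in>I. \<forall>t\<in>{a..b}. (w i t)\<^sup>2 \<le> A i t"
    "\<forall>i\<in>I. \<forall>t\<in>{a..b}. h i t \<noteq> 0 \<longrightarrow> A i t \<le> \<beta> i"
    "\<forall>i\<in>I. 0 \<le> \<beta> i" "(\<Sum>i\<in>I. \<beta> i) \<le> e"
proof -
  \<comment> \<open>The merged piece around \<open>c\<close> will cost \<open>2 * r\<close>, all
    other pieces together at most \<open>r\<close>.\<close>
  define r where "r = e / 3"
  have "r > 0" using \<open>e > 0\<close> by (simp add: r_def)
  note conv = strictly_convex_on_imp_convex_on[OF strict]
  have c_in: "c \<in> {a..b}" using c by simp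
  have sq_le: "(t - c)\<^sup>2 \<le> (b - a)\<^sup>2" if "t \<in> {a..b}" for t
    using that c by (intro power2_le_iff_abs_le[THEN iffD2]) auto

  obtain mc where mc: "\<And>t. t \<in> {a..b} \<Longrightarrow> f c + mc * (t - c) \<le> f t"
    using subgradient_exists[OF conv c] by blast
  define E where "E t = f t - f c - mc * (t - c)" for t
  have E_nonneg: "0 \<le> E t" if "t \<in> {a..b}" for t
    using mc[OF that] by (simp add: E_def)
  have contE: "continuous_on {a..b} E"
    unfolding E_def by (intro continuous_intros cont)
  obtain \<kappa>1 where \<kappa>1: "\<kappa>1 > 0" "\<And>t. t \<in> {a..b} \<Longrightarrow> sqrt r \<le> \<bar>t - c\<bar> \<Longrightarrow> \<kappa>1 \<le> E t"
    unfolding E_def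
    using strictly_convex_on_tangent_gap[OF cont strict, of "sqrt r"] \<open>r > 0\<close> mc c_in
    by (metis real_sqrt_gt_zero)
  \<comment> \<open>Scaled so that \<open>C1 * E t\<close> dominates every possible
    \<open>(t - c)\<^sup>2\<close> once \<open>\<bar>t - c\<bar>\<close> reaches
    \<open>sqrt r\<close>; closer to \<open>c\<close> the constant \<open>r\<close> suffices.
    \<open>C\<close> below is chosen likewise for the other tangents.\<close>
  define C1 where "C1 = (b - a)\<^sup>2 / \<kappa>1"
  have "C1 \<ge> 0" using \<kappa>1 by (simp add: C1_def)
  have near: "(t - c)\<^sup>2 \<le> r + C1 * E t" if t: "t \<in> {a..b}" for t
  proof (cases "sqrt r \<le> \<bar>t - c\<bar>")
    case True
    have "(b - a)\<^sup>2 = C1 * \<kappa>1" using \<kappa>1 by (simp add: C1_def)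
    also have "\<dots> \<le> C1 * E t" using \<kappa>1(2)[OF t True] \<open>C1 \<ge> 0\<close> by (rule mult_left_mono)
    finally show ?thesis using sq_le[OF t] \<open>r > 0\<close> by linarith
  next
    case False
    then have "(t - c)\<^sup>2 \<le> (sqrt r)\<^sup>2"
      using \<open>r > 0\<close> by (intro power2_le_iff_abs_le[THEN iffD2]) auto
    moreover have "0 \<le> C1 * E t"
      using \<open>C1 \<ge> 0\<close> E_nonneg[OF t] by simp
    ultimately show ?thesis using \<open>r > 0\<close> by simp
  qed
  have "continuous_on {a..b} (\<lambda>t. C1 * E t)"
    by (intro continuous_intros contE)
  then obtain \<rho> where \<rho>: "\<rho> > 0" "\<And>t. t \<in> {a..b} \<Longrightarrow> \<bar>t - c\<bar> < \<rho> \<Longrightarrow> \<bar>C1 * E t - C1 * E c\<bar> < r"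
    unfolding continuous_on_iff dist_real_def using c_in \<open>r > 0\<close> by metis
  have E_near: "C1 * E t \<le> r" if "t \<in> {a..b}" "\<bar>t - c\<bar> < \<rho>" for t
    using \<rho>(2)[OF that] by (simp add: E_def)

  obtain \<kappa> where \<kappa>: "\<kappa> > 0"
    "\<And>p m t. (\<And>s. s \<in> {a..b} \<Longrightarrow> f p + m * (s - p) \<le> f s) \<Longrightarrow> p \<in> {a..b} \<Longrightarrow> t \<in> {a..b} \<Longrightarrow>
      \<rho> / 2 \<le> \<bar>t - p\<bar> \<Longrightarrow> \<kappa> \<le> f t - f p - m * (t - p)"
    using strictly_convex_on_tangent_gap[OF cont strict, of "\<rho> / 2"] \<rho>(1) by (metis half_gt_zero_iff)
  define C where "C = (b - a)\<^sup>2 / \<kappa>"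
  have "C \<ge> 0" using \<kappa> by (simp add: C_def)
  \<comment> \<open>The first tolerance keeps \<open>C\<close> times the sum of the
    \<open>B k\<close> below \<open>r\<close>; the second keeps the merged support within
    \<open>\<rho> / 2 + \<rho> / 4 < \<rho>\<close> of \<open>c\<close>.\<close>
  have "a < b" "r / (C + 1) > 0" "\<rho> / 4 > 0"
    using \<open>r > 0\<close> \<open>C \<ge> 0\<close> \<rho> c by auto
  then obtain h :: "nat \<Rightarrow> real \<Rightarrow> real" and N :: nat and p m B where
    h: "\<forall>k. continuous_on {a..b} (h k)" "\<forall>k t. 0 \<le> h k t" "\<forall>t. (\<Sum>k<N. h k t) = 1"
    and p: "\<forall>k<N. p k \<in> {a..b}"
    and m: "\<forall>k<N. \<forall>t\<in>{a..b}. f (p k) + m k * (t - p k) \<le> f t"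
    and supp: "\<forall>k<N. \<forall>t\<in>{a..b}. h k t \<noteq> 0 \<longrightarrow>
        \<bar>t - p k\<bar> \<le> \<rho> / 4 \<and> f t - f (p k) - m k * (t - p k) \<le> B k"
    and B: "\<forall>k<N. 0 \<le> B k" "(\<Sum>k<N. B k) \<le> r / (C + 1)"
    by (rule tangent_partition_of_unity[OF cont conv])
  note h = h[rule_format] and p = p[rule_format] and m = m[rule_format]
    and supp = supp[rule_format] and B = B[rule_format]
  define Mid where "Mid = {k. k < N \<and> \<bar>p k - c\<bar> < \<rho> / 2}"
  \<comment> \<open>\<open>N\<close> is a fresh index, used for the merged piece.\<close>
  define I where "I = insert N ({..<N} - Mid)"
  define h' where "h' k t = (if k = N then (\<Sum>j\<in>Mid. h j t) else h k t)" for k t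
  \<comment> \<open>Each unmerged piece takes the hinge that vanishes on the side of
    \<open>c\<close> containing its node; for the merged piece either hinge would do.\<close>
  define w where "w k t = (if k < N \<and> c < p k then max (c - t) 0 else max (t - c) 0)" for k t
  define A where "A k t = (if k = N then r + C1 * E t else C * (f t - f (p k) - m k * (t - p k)))" for k t
  define \<beta> where "\<beta> k = (if k = N then 2 * r else C * B k)" for k
  have Mid: "Mid \<subseteq> {..<N}" "finite Mid"
    by (auto simp: Mid_def intro: finite_subset[of _ "{..<N}"])
  have sumI: "(\<Sum>i\<in>I. g i) = g N + (\<Sum>i\<in>{..<N} - Mid. g i)" for g :: "nat \<Rightarrow> real"
    unfolding I_def by (subst sum.insert) auto
  have w_sq: "(w k t)\<^sup>2 \<le> (t - c)\<^sup>2" for k t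
    by (auto simp: w_def max_def power2_commute)
  have r1: "finite I" by (simp add: I_def)
  have r2: "continuous_on {a..b} (h' i)" for i
    unfolding h'_def by (cases "i = N") (auto intro!: continuous_intros h)
  have r3: "0 \<le> h' i t" for i t
    by (simp add: h'_def h sum_nonneg)
  have r4: "(\<Sum>i\<in>I. h' i t) = 1" for t
  proof -
    have "(\<Sum>i\<in>{..<N} - Mid. h' i t) = (\<Sum>i\<in>{..<N} - Mid. h i t)"
      by (rule sum.cong) (auto simp: h'_def)
    then show ?thesis
      using h(3)[of t] sum.subset_diff[OF Mid(1) finite_lessThan, of "\<lambda>i. h i t"]
      by (simp add: sumI h'_def)
  qed
  have r5: "w i = (\<lambda>t. max (t - c) 0) \<or> w i = (\<lambda>t. max (c - t) 0)" for i
    by (auto simp: w_def fun_eq_iff)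
  have r6: "\<exists>\<alpha> \<gamma> C. A i = (\<lambda>t. \<alpha> + \<gamma> * t + C * f t)" for i
  proof (cases "i = N")
    case True
    then show ?thesis
      by (intro exI[of _ "r - C1 * f c + C1 * mc * c"] exI[of _ "- C1 * mc"] exI[of _ C1])
         (simp add: A_def E_def fun_eq_iff algebra_simps)
  next
    case False
    then show ?thesis
      by (intro exI[of _ "C * (m i * p i - f (p i))"] exI[of _ "- C * m i"] exI[of _ C])
         (simp add: A_def fun_eq_iff algebra_simps)
  qed
  have r7: "(w i t)\<^sup>2 \<le> A i t" if i: "i \<in> I" and t: "t \<in> {a..b}" for i t
  proof (cases "i = N")
    case True
    then show ?thesis using near[OF t] w_sq[of i t] by (simp add: A_def)
  next
    case False
    then have i: "i < N" "\<rho> / 2 \<le> \<bar>p i - c\<bar>"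
      using i by (auto simp: I_def Mid_def)
    define G where "G = f t - f (p i) - m i * (t - p i)"
    have A: "A i t = C * G" using False by (simp add: A_def G_def)
    have "0 \<le> G" using m[OF i(1) t] by (simp add: G_def)
    show ?thesis
    proof (cases "w i t = 0")
      case True
      then show ?thesis using A \<open>0 \<le> G\<close> \<open>C \<ge> 0\<close> by simp
    next
      case False
      \<comment> \<open>Where the hinge is nonzero, \<open>c\<close> separates \<open>t\<close> from
        the node, so \<open>t\<close> is at least as far from it as \<open>c\<close> is.\<close>
      then have "\<rho> / 2 \<le> \<bar>t - p i\<bar>"
        using i by (auto simp: w_def max_def split: if_splits)
      then have "\<kappa> \<le> G"
        unfolding G_def using m i(1) p t by (intro \<kappa>(2)) auto
      have "(b - a)\<^sup>2 = C * \<kappa>" using \<kappa> by (simp add: C_def)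
      also have "\<dots> \<le> A i t"
        unfolding A using \<open>\<kappa> \<le> G\<close> \<open>C \<ge> 0\<close> by (rule mult_left_mono)
      finally show ?thesis using sq_le[OF t] w_sq[of i t] by linarith
    qed
  qed
  have r8: "A i t \<le> \<beta> i" if i: "i \<in> I" and t: "t \<in> {a..b}" and "h' i t \<noteq> 0" for i t
  proof (cases "i = N")
    case True
    then obtain j where j: "j \<in> Mid" "h j t \<noteq> 0"
      using \<open>h' i t \<noteq> 0\<close> by (auto simp: h'_def intro: sum.not_neutral_contains_not_neutral)
    then have "\<bar>t - p j\<bar> \<le> \<rho> / 4" "\<bar>p j - c\<bar> < \<rho> / 2"
      using supp[OF _ t, of j] by (auto simp: Mid_def)
    then have "\<bar>t - c\<bar> < \<rho>" using \<rho>(1) by linarith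
    then show ?thesis using E_near[OF t] True by (simp add: A_def \<beta>_def)
  next
    case False
    then show ?thesis
      using i \<open>h' i t \<noteq> 0\<close> \<open>C \<ge> 0\<close> supp[OF _ t]
      by (auto simp: A_def \<beta>_def h'_def I_def intro!: mult_left_mono)
  qed
  have r9: "0 \<le> \<beta> i" if "i \<in> I" for i
    using that \<open>r > 0\<close> \<open>C \<ge> 0\<close> B(1) by (auto simp: \<beta>_def I_def)
  have r10: "(\<Sum>i\<in>I. \<beta> i) \<le> e"
  proof -
    have "(\<Sum>i\<in>{..<N} - Mid. \<beta> i) = C * (\<Sum>i\<in>{..<N} - Mid. B i)"
      unfolding sum_distrib_left by (rule sum.cong) (auto simp: \<beta>_def)
    also have "\<dots> \<le> C * (\<Sum>k<N. B k)"
      using \<open>C \<ge> 0\<close> B(1) by (intro mult_left_mono sum_mono2) auto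
    also have "\<dots> \<le> C * (r / (C + 1))"
      using \<open>C \<ge> 0\<close> B(2) by (intro mult_left_mono)
    also have "\<dots> \<le> r"
      using \<open>C \<ge> 0\<close> \<open>r > 0\<close> by (simp add: field_simps)
    finally show ?thesis
      unfolding sumI by (simp add: \<beta>_def r_def)
  qed
  show ?thesis
    by (rule that[of I h' w A \<beta>]) (use r1 r2 r3 r4 r5 r6 r7 r8 r9 r10 in blast)+
qed

section \<open>The square as a limit of hinge sums\<close>

lemma square_hinge_step:
  fixes z d :: real
  assumes "d > 0"
  shows "2 * d * max (z - d) 0 \<le> (max z 0)\<^sup>2 - (max (z - d) 0)\<^sup>2"
    and "(max z 0)\<^sup>2 - (max (z - d) 0)\<^sup>2 \<le> 2 * d * max z 0"
proof -
  consider "z \<le> 0" | "0 < z" "z \<le> d" | "d < z" by linarith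
  then have "2 * d * max (z - d) 0 \<le> (max z 0)\<^sup>2 - (max (z - d) 0)\<^sup>2 \<and>
    (max z 0)\<^sup>2 - (max (z - d) 0)\<^sup>2 \<le> 2 * d * max z 0"
  proof cases
    case 1 then show ?thesis using assms by simp
  next
    case 2
    then have "z * z \<le> 2 * d * z" using assms by (intro mult_right_mono) auto
    with 2 show ?thesis by (simp add: power2_eq_square)
  next
    case 3
    then have m: "max z 0 = z" "max (z - d) 0 = z - d"
      using assms by auto
    have "z\<^sup>2 - (z - d)\<^sup>2 = 2 * d * z - d * d"
      by (simp add: power2_eq_square algebra_simps)
    moreover have "0 \<le> d * d" "2 * d * (z - d) = 2 * d * z - 2 * (d * d)"
      by (simp_all add: algebra_simps)
    ultimately show ?thesis unfolding m by linarith
  qed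
  then show "2 * d * max (z - d) 0 \<le> (max z 0)\<^sup>2 - (max (z - d) 0)\<^sup>2"
    and "(max z 0)\<^sup>2 - (max (z - d) 0)\<^sup>2 \<le> 2 * d * max z 0" by auto
qed

text \<open>These are Riemann sums with mesh \<open>d\<close> for \<open>x\<^sup>2\<close>, written
  as twice the integral of \<open>max (x - s) 0\<close> over \<open>s \<ge> 0\<close>. The integrand
  is decreasing in \<open>s\<close>, so lower and upper sum differ by the term at
  \<open>s = 0\<close> alone, which is \<open>2 * d * x\<close>.\<close>

lemma square_hinge_sum:
  fixes d x :: real
  assumes "d > 0" and x: "0 \<le> x" "x \<le> real (Suc n) * d"
  defines "L \<equiv> 2 * d * (\<Sum>k<n. max (x - real (Suc k) * d) 0)"
  shows "L \<le> x\<^sup>2" and "x\<^sup>2 \<le> L + 2 * d * x"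
proof -
  define q where "q k = (max (x - real k * d) 0)\<^sup>2" for k
  have step: "2 * d * max (x - real (Suc k) * d) 0 \<le> q k - q (Suc k)"
    "q k - q (Suc k) \<le> 2 * d * max (x - real k * d) 0" for k
    using square_hinge_step[OF assms(1), of "x - real k * d"] by (simp_all add: q_def algebra_simps)
  have tele: "(\<Sum>k<Suc n. q k - q (Suc k)) = x\<^sup>2"
    using sum_lessThan_telescope'[of q "Suc n"] x by (simp add: q_def)
  \<comment> \<open>The added last term is zero because
    \<open>x \<le> real (Suc n) * d\<close>.\<close>
  have "L = (\<Sum>k<Suc n. 2 * d * max (x - real (Suc k) * d) 0)"
    using x by (simp add: L_def sum_distrib_left)
  also have "\<dots> \<le> x\<^sup>2"
    unfolding tele[symmetric] by (intro sum_mono step)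
  finally show "L \<le> x\<^sup>2" .
  have "x\<^sup>2 \<le> (\<Sum>k<Suc n. 2 * d * max (x - real k * d) 0)"
    unfolding tele[symmetric] by (intro sum_mono step)
  also have "\<dots> = L + 2 * d * x"
    unfolding sum.lessThan_Suc_shift using x by (simp add: L_def sum_distrib_left)
  finally show "x\<^sup>2 \<le> L + 2 * d * x" .
qed

section \<open>Unital completely positive maps\<close>

text \<open>Self-adjointness makes the bilinear form symmetric, so it is recovered from its
  quadratic form by expanding at \<open>x + y\<close>. Operator identities thus reduce to scalar
  estimates.\<close>

lemma selfadjoint_op_eqI:
  assumes "selfadjoint_op S" "selfadjoint_op T" and eq: "\<And>y. rinner y (S y) = rinner y (T y)"
  shows "S = T"
proof (rule blinfun_eqI, rule rinner_eqI)
  fix x y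
  have "rinner (x + y) (S (x + y)) = rinner (x + y) (T (x + y))" by (rule eq)
  then have "rinner x (S y) + rinner y (S x) = rinner x (T y) + rinner y (T x)"
    using eq[of x] eq[of y] by (simp add: blinfun.add_right rinner.add_left rinner.add_right)
  moreover have "rinner x (S y) = rinner y (S x)" "rinner x (T y) = rinner y (T x)"
    using selfadjoint_opD(3)[OF assms(1), of x y] selfadjoint_opD(3)[OF assms(2), of x y]
    by (metis rinner_commute)+
  ultimately show "rinner (S x) y = rinner (T x) y"
    by (metis mult_2 mult_left_cancel rinner_commute zero_neq_numeral)
qed

locale ucp_map =
  fixes \<phi> :: "('h :: chilbert_space \<Rightarrow>\<^sub>L 'h) \<Rightarrow> ('k :: chilbert_space \<Rightarrow>\<^sub>L 'k)"
  assumes completely_positive: "completely_positive \<phi>" and unital: "unital_map \<phi>"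
begin

lemma map_in_bounded_ops [simp]: "S \<in> bounded_ops \<Longrightarrow> \<phi> S \<in> bounded_ops"
  and map_add: "S \<in> bounded_ops \<Longrightarrow> T \<in> bounded_ops \<Longrightarrow> \<phi> (S + T) = \<phi> S + \<phi> T"
  and map_scaleC: "T \<in> bounded_ops \<Longrightarrow> \<phi> (c *\<^sub>C T) = c *\<^sub>C \<phi> T"
  and map_id [simp]: "\<phi> id_blinfun = id_blinfun"
  using completely_positive unital by (auto simp: completely_positive_def unital_map_def)

lemma map_scaleR: "T \<in> bounded_ops \<Longrightarrow> \<phi> (r *\<^sub>R T) = r *\<^sub>R \<phi> T"
  by (simp add: scaleR_scaleC map_scaleC)

lemma map_zero: "\<phi> 0 = 0"
  using map_scaleR[of 0 0] by simp

lemma map_diff: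
  assumes "S \<in> bounded_ops" "T \<in> bounded_ops"
  shows "\<phi> (S - T) = \<phi> S - \<phi> T"
  using map_add[of "S - T" T] assms by (simp add: algebra_simps)

lemma map_sum:
  assumes "\<And>i. i \<in> I \<Longrightarrow> g i \<in> bounded_ops"
  shows "\<phi> (\<Sum>i\<in>I. g i) = (\<Sum>i\<in>I. \<phi> (g i))"
  using assms
  by (induction I rule: infinite_finite_induct) (simp_all add: map_zero map_add bounded_ops_sum)

lemma map_positive_op_matrix:
  "(\<And>i j. i < n \<Longrightarrow> j < n \<Longrightarrow> T i j \<in> bounded_ops) \<Longrightarrow> positive_op_matrix n T \<Longrightarrow>
    positive_op_matrix n (\<lambda>i j. \<phi> (T i j))"
  using completely_positive unfolding completely_positive_def by blast

text \<open>The matrix with rows \<open>(1, X)\<close> and \<open>(X, X\<^sup>2)\<close> has the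
  form \<open>\<parallel>v\<^sub>0 + X v\<^sub>1\<parallel>\<^sup>2\<close>, so its image is
  positive. The complex statement is kept: imaginary parts give self-adjointness of
  \<open>\<phi> X\<close>, real parts give Kadison's inequality.\<close>

lemma map_square_form:
  assumes X: "selfadjoint_op X"
  shows "cinner x x + cinner x (\<phi> X y) + (cinner y (\<phi> X x) + cinner y (\<phi> (X o\<^sub>L X) y)) \<in> \<real>\<^sub>\<ge>\<^sub>0"
proof -
  define M where "M i j = (if i = 0 then if j = 0 then id_blinfun else X
      else if j = 0 then X else X o\<^sub>L X)" for i j :: nat
  note XB = selfadjoint_opD(1)[OF X]
  have "positive_op_matrix 2 M"
    unfolding positive_op_matrix_def
  proof
    fix v :: "nat \<Rightarrow> 'h"
    have "(\<Sum>i<2. \<Sum>j<2. cinner (v i) (M i j (v j))) = cinner (v 0 + X (v 1)) (v 0 + X (v 1))"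
      by (simp add: M_def numeral_2_eq_2 cinner_add_left cinner_add_right selfadjoint_opD(2)[OF X])
    then show "(\<Sum>i<2. \<Sum>j<2. cinner (v i) (M i j (v j))) \<in> \<real>\<^sub>\<ge>\<^sub>0"
      by (simp add: cinner_self)
  qed
  then have "positive_op_matrix 2 (\<lambda>i j. \<phi> (M i j))"
    by (rule map_positive_op_matrix[rotated]) (use XB in \<open>simp add: M_def\<close>)
  then have "(\<Sum>i<2. \<Sum>j<2. cinner ((case_nat x (\<lambda>_. y)) i) (\<phi> (M i j) ((case_nat x (\<lambda>_. y)) j))) \<in> \<real>\<^sub>\<ge>\<^sub>0"
    unfolding positive_op_matrix_def by blast
  then show ?thesis
    by (simp add: M_def numeral_2_eq_2)
qed

text \<open>Compatibility with adjoints is hidden in the reality of the form: \<open>x = 0\<close>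
  shows that the term with \<open>\<phi> (X o\<^sub>L X)\<close> is real, and the imaginary parts of
  the two cross terms must then cancel.\<close>

lemma selfadjoint_map:
  assumes X: "selfadjoint_op X"
  shows "selfadjoint_op (\<phi> X)"
proof (rule selfadjoint_opI)
  show XB: "\<phi> X \<in> bounded_ops" using selfadjoint_opD(1)[OF X] by simp
  have im: "Im (cinner x (\<phi> X y)) = Im (cinner (\<phi> X x) y)" for x y :: 'k
  proof -
    have "Im (cinner y (\<phi> (X o\<^sub>L X) y)) = 0"
      using map_square_form[OF X, of 0 y] by (simp add: complex_nonneg_Reals_iff)
    then have "Im (cinner x (\<phi> X y)) + Im (cinner y (\<phi> X x)) = 0"
      using map_square_form[OF X, of x y] by (simp add: complex_nonneg_Reals_iff cinner_self)
    moreover have "Im (cinner y (\<phi> X x)) = - Im (cinner (\<phi> X x) y)"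
      by (subst cinner_commute) simp
    ultimately show ?thesis by simp
  qed
  fix x y :: 'k
  \<comment> \<open>Writing \<open>x\<close> as \<open>\<i>\<close> times another vector turns the
    identity of imaginary parts into one of real parts.\<close>
  have "x = \<i> *\<^sub>C (- \<i>) *\<^sub>C x"
    by (simp add: scaleC_scaleC)
  then show "rinner (\<phi> X x) y = rinner x (\<phi> X y)"
    using im[of "(- \<i>) *\<^sub>C x" y] bounded_opsD[OF XB, of \<i> "(- \<i>) *\<^sub>C x"]
    by (simp add: Im_cinner)
qed

text \<open>The vector \<open>- \<phi> X y\<close> minimises the form of
  \<open>map_square_form\<close> over its first argument, and the minimum is the difference of the
  two sides.\<close>

lemma kadison_inequality:
  assumes X: "selfadjoint_op X"
  shows "(norm (\<phi> X y))\<^sup>2 \<le> rinner y (\<phi> (X o\<^sub>L X) y)"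
proof -
  define z where "z = \<phi> X y"
  have "0 \<le> rinner (- z) (- z) + rinner (- z) z + (rinner y (\<phi> X (- z)) + rinner y (\<phi> (X o\<^sub>L X) y))"
    using map_square_form[OF X, of "- z" y] by (simp add: complex_nonneg_Reals_iff rinner_def z_def)
  moreover have "rinner y (\<phi> X (- z)) = - rinner z z"
    using selfadjoint_opD(3)[OF selfadjoint_map[OF X], of y z]
    by (simp add: z_def blinfun.minus_right rinner.minus_right)
  ultimately show ?thesis
    by (simp add: rinner.minus_left rinner.minus_right rinner_self flip: z_def)
qed

lemma map_positive:
  assumes P: "selfadjoint_op P" and "\<And>x. 0 \<le> rinner x (P x)"
  shows "0 \<le> rinner y (\<phi> P y)"
proof -
  have "Im (cinner x (P x)) = 0" for x
  proof -
    have "cinner x (P x) = cnj (cinner x (P x))"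
      by (metis cinner_commute selfadjoint_opD(2)[OF P])
    then have "Im (cinner x (P x)) = - Im (cinner x (P x))"
      by (metis cnj.sel(2))
    then show ?thesis by simp
  qed
  then have "positive_op_matrix 1 (\<lambda>_ _. P)"
    using assms(2) by (auto simp: positive_op_matrix_def complex_nonneg_Reals_iff rinner_def)
  then have "positive_op_matrix 1 (\<lambda>_ _. \<phi> P)"
    by (rule map_positive_op_matrix[rotated]) (rule selfadjoint_opD(1)[OF P])
  from this[unfolded positive_op_matrix_def, rule_format, of "\<lambda>_. y"]
  have "cinner y (\<phi> P y) \<in> \<real>\<^sub>\<ge>\<^sub>0"
    by simp
  then show ?thesis by (simp add: rinner_def complex_nonneg_Reals_iff)
qed

end

section \<open>Functions of \<open>H\<close> preserved by the map\<close>

locale ucp_calculus = ucp_map \<phi> + H: selfadjoint_calculus H a b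
  for \<phi> :: "('h :: chilbert_space \<Rightarrow>\<^sub>L 'h) \<Rightarrow> ('k :: chilbert_space \<Rightarrow>\<^sub>L 'k)" and H :: "'h \<Rightarrow>\<^sub>L 'h" and a b :: real
begin

lemma map_fc_mono:
  assumes "continuous_on {a..b} g" "continuous_on {a..b} h" and "\<And>t. t \<in> {a..b} \<Longrightarrow> g t \<le> h t"
  shows "rinner y (\<phi> (H.fc g) y) \<le> rinner y (\<phi> (H.fc h) y)"
proof -
  have "0 \<le> rinner y (\<phi> (H.fc (\<lambda>t. h t - g t)) y)"
    using assms by (intro map_positive H.selfadjoint_fc H.fc_nonneg continuous_on_diff) auto
  also have "H.fc (\<lambda>t. h t - g t) = H.fc h - H.fc g"
    by (rule H.fc_diff) fact+
  also have "\<phi> \<dots> = \<phi> (H.fc h) - \<phi> (H.fc g)"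
    using assms by (intro map_diff selfadjoint_opD(1) H.selfadjoint_fc)
  finally show ?thesis
    by (simp add: minus_blinfun.rep_eq rinner.diff_right)
qed

text \<open>The bounds \<open>a \<le> H \<le> b\<close> pass through the positive unital map as
  bounds on the quadratic form, which confine the spectrum of \<open>\<phi> H\<close>; only then do
  functions on the interval act on \<open>\<phi> H\<close>.\<close>

sublocale K: selfadjoint_calculus "\<phi> H" a b
proof
  show "selfadjoint_op (\<phi> H)"
    by (rule selfadjoint_map[OF H.selfadjoint])
  then show "op_spectrum (\<phi> H) \<subseteq> complex_of_real ` {a..b}"
  proof (rule op_spectrum_selfadjoint)
    fix y
    show "a * (norm y)\<^sup>2 \<le> rinner y (\<phi> H y)"
      using map_fc_mono[of "\<lambda>t. a" "\<lambda>t. t" y, OF continuous_on_const continuous_on_id]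
      unfolding H.fc_const H.fc_id map_scaleR[OF bounded_ops_id] map_id
      by (simp add: scaleR_blinfun.rep_eq rinner.scaleR_right rinner_self)
    show "rinner y (\<phi> H y) \<le> b * (norm y)\<^sup>2"
      using map_fc_mono[of "\<lambda>t. t" "\<lambda>t. b" y, OF continuous_on_id continuous_on_const]
      unfolding H.fc_const H.fc_id map_scaleR[OF bounded_ops_id] map_id
      by (simp add: scaleR_blinfun.rep_eq rinner.scaleR_right rinner_self)
  qed
qed

definition preserved :: "(real \<Rightarrow> real) \<Rightarrow> bool" where
  "preserved g \<longleftrightarrow> continuous_on {a..b} g \<and> \<phi> (H.fc g) = K.fc g"

lemma fc_in_bounded_ops: "continuous_on {a..b} g \<Longrightarrow> H.fc g \<in> bounded_ops"
  by (rule selfadjoint_opD(1)[OF H.selfadjoint_fc])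

lemma preserved_const: "preserved (\<lambda>t. c)"
  by (simp add: preserved_def H.fc_const K.fc_const map_scaleR)

lemma preserved_id: "preserved (\<lambda>t. t)"
  by (simp add: preserved_def H.fc_id K.fc_id)

lemma preserved_add: "preserved g \<Longrightarrow> preserved h \<Longrightarrow> preserved (\<lambda>t. g t + h t)"
  by (simp add: preserved_def H.fc_add K.fc_add map_add fc_in_bounded_ops continuous_on_add)

lemma preserved_scale: "preserved g \<Longrightarrow> preserved (\<lambda>t. c * g t)"
  by (simp add: preserved_def H.fc_scaleR K.fc_scaleR map_scaleR fc_in_bounded_ops
      continuous_on_mult_left)

lemma preserved_sum: "(\<And>i. i \<in> I \<Longrightarrow> preserved (g i)) \<Longrightarrow> preserved (\<lambda>t. \<Sum>i\<in>I. g i t)"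
  by (induction I rule: infinite_finite_induct) (simp_all add: preserved_const preserved_add)

text \<open>With \<open>y\<^sub>i = h\<^sub>i(\<phi>(H)) y\<close>, Kadison's inequality and \<open>w\<^sub>i\<^sup>2 \<le> A\<^sub>i\<close> bound both \<open>\<phi>(w\<^sub>i(H)) y\<^sub>i\<close> and
  \<open>w\<^sub>i(\<phi>(H)) y\<^sub>i\<close> by \<open>sqrt \<beta>\<^sub>i \<parallel>y\<^sub>i\<parallel>\<close>, because \<open>A\<^sub>i\<close> is preserved and at most \<open>\<beta>\<^sub>i\<close> on the support
  of \<open>h\<^sub>i\<close>.\<close>

lemma norm_defect_le:
  fixes h w A :: "'i \<Rightarrow> real \<Rightarrow> real"
  assumes g: "continuous_on {a..b} g" and "finite I"
    and h: "\<And>i. continuous_on {a..b} (h i)" "\<And>i t. 0 \<le> h i t" "\<And>t. (\<Sum>i\<in>I. h i t) = 1"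
    and w: "\<And>i. continuous_on {a..b} (w i)" "\<And>i. preserved (\<lambda>t. w i t - g t)"
    and A: "\<And>i. preserved (A i)" "\<And>i t. i \<in> I \<Longrightarrow> t \<in> {a..b} \<Longrightarrow> (w i t)\<^sup>2 \<le> A i t"
      "\<And>i t. i \<in> I \<Longrightarrow> t \<in> {a..b} \<Longrightarrow> h i t \<noteq> 0 \<Longrightarrow> A i t \<le> \<beta> i"
    and \<beta>: "\<And>i. i \<in> I \<Longrightarrow> 0 \<le> \<beta> i" "(\<Sum>i\<in>I. \<beta> i) \<le> e"
  shows "(norm ((\<phi> (H.fc g) - K.fc g) y))\<^sup>2 \<le> 4 * e * (norm y)\<^sup>2"
proof -
  define Z where "Z = \<phi> (H.fc g) - K.fc g"
  define v where "v i = K.fc (h i) y" for i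
  have A_cont: "continuous_on {a..b} (A i)" for i
    using A(1) by (simp add: preserved_def)
  \<comment> \<open>The defect is linear and zero on preserved functions, so every
    \<open>w i\<close> has the same defect as \<open>g\<close> and may replace it on its own
    piece.\<close>
  have Z_w: "Z = \<phi> (H.fc (w i)) - K.fc (w i)" for i
  proof -
    have "\<phi> (H.fc (w i)) - \<phi> (H.fc g) = \<phi> (H.fc (\<lambda>t. w i t - g t))"
      using w(1) g by (simp add: H.fc_diff map_diff fc_in_bounded_ops)
    also have "\<dots> = K.fc (w i) - K.fc g"
      using w g by (simp add: preserved_def K.fc_diff)
    finally show ?thesis by (simp add: Z_def algebra_simps)
  qed
  have A_form: "rinner (v i) (K.fc (A i) (v i)) \<le> \<beta> i * (norm (v i))\<^sup>2" if i: "i \<in> I" for i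
  proof -
    have "rinner (v i) (K.fc (A i) (v i)) = rinner y (K.fc (\<lambda>t. h i t * (A i t * h i t)) y)"
      using h A_cont selfadjoint_opD(3)[OF K.selfadjoint_fc[OF h(1)]]
      by (simp add: v_def K.fc_mult continuous_on_mult)
    also have "\<dots> \<le> rinner y (K.fc (\<lambda>t. \<beta> i * (h i t)\<^sup>2) y)"
    proof (rule K.fc_mono)
      show "h i t * (A i t * h i t) \<le> \<beta> i * (h i t)\<^sup>2" if "t \<in> {a..b}" for t
        using mult_right_mono[OF A(3)[OF i that], of "(h i t)\<^sup>2"]
        by (cases "h i t = 0") (auto simp: power2_eq_square algebra_simps)
    qed (intro continuous_intros h A_cont)+
    also have "\<dots> = \<beta> i * (norm (v i))\<^sup>2"
      unfolding v_def K.norm_fc_square[OF h(1)]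
      by (subst K.fc_scaleR) (auto intro!: continuous_intros h simp: scaleR_blinfun.rep_eq rinner.scaleR_right)
    finally show ?thesis .
  qed
  have Z_v: "norm (Z (v i)) \<le> 2 * (sqrt (\<beta> i) * norm (v i))" if i: "i \<in> I" for i
  proof -
    have w2: "continuous_on {a..b} (\<lambda>t. (w i t)\<^sup>2)"
      by (intro continuous_intros w)
    have "(norm (\<phi> (H.fc (w i)) (v i)))\<^sup>2 \<le> rinner (v i) (\<phi> (H.fc (w i) o\<^sub>L H.fc (w i)) (v i))"
      by (intro kadison_inequality H.selfadjoint_fc w)
    also have "H.fc (w i) o\<^sub>L H.fc (w i) = H.fc (\<lambda>t. (w i t)\<^sup>2)"
      using H.fc_mult[OF w(1) w(1)] by (simp add: power2_eq_square)
    also have "rinner (v i) (\<phi> (H.fc (\<lambda>t. (w i t)\<^sup>2)) (v i)) \<le> rinner (v i) (\<phi> (H.fc (A i)) (v i))"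
      by (intro map_fc_mono w2 A_cont A(2) i)
    also have "\<dots> \<le> \<beta> i * (norm (v i))\<^sup>2"
      using A_form[OF i] A(1) by (simp add: preserved_def)
    finally have 1: "(norm (\<phi> (H.fc (w i)) (v i)))\<^sup>2 \<le> \<beta> i * (norm (v i))\<^sup>2" .
    have "(norm (K.fc (w i) (v i)))\<^sup>2 \<le> rinner (v i) (K.fc (A i) (v i))"
      unfolding K.norm_fc_square[OF w(1)] by (intro K.fc_mono w2 A_cont A(2) i)
    also note A_form[OF i]
    finally have 2: "(norm (K.fc (w i) (v i)))\<^sup>2 \<le> \<beta> i * (norm (v i))\<^sup>2" .
    have "norm (Z (v i)) \<le> norm (\<phi> (H.fc (w i)) (v i)) + norm (K.fc (w i) (v i))"
      unfolding Z_w[of i] minus_blinfun.rep_eq by (rule norm_triangle_ineq4)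
    also have "\<dots> \<le> sqrt (\<beta> i) * norm (v i) + sqrt (\<beta> i) * norm (v i)"
      using real_sqrt_le_mono[OF 1] real_sqrt_le_mono[OF 2] by (intro add_mono) (simp_all add: real_sqrt_mult)
    finally show ?thesis by simp
  qed
  have "(\<Sum>i\<in>I. v i) = K.fc (\<lambda>t. \<Sum>i\<in>I. h i t) y"
    by (simp add: K.fc_sum h(1) v_def blinfun.sum_left)
  then have sum_v: "(\<Sum>i\<in>I. v i) = y"
    by (simp add: h(3) K.fc_const)
  \<comment> \<open>The pieces overlap and are not orthogonal, but
    \<open>0 \<le> h i t \<le> 1\<close> gives \<open>(h i t)\<^sup>2 \<le> h i t\<close>, which
    still bounds their total square norm.\<close>
  have "(\<Sum>i\<in>I. (norm (v i))\<^sup>2) = rinner y (K.fc (\<lambda>t. \<Sum>i\<in>I. (h i t)\<^sup>2) y)"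
    using h(1) by (simp add: v_def K.norm_fc_square K.fc_sum continuous_on_power blinfun.sum_left rinner.sum_right)
  also have "\<dots> \<le> rinner y (K.fc (\<lambda>t. 1) y)"
  proof (rule K.fc_mono)
    fix t
    have "(h i t)\<^sup>2 \<le> h i t" if "i \<in> I" for i
    proof -
      have "h i t \<le> (\<Sum>j\<in>I. h j t)"
        using that \<open>finite I\<close> h(2) by (intro member_le_sum) auto
      then show ?thesis
        using h(2)[of i t] h(3)[of t] by (simp add: power2_eq_square mult_left_le)
    qed
    then show "(\<Sum>i\<in>I. (h i t)\<^sup>2) \<le> 1"
      unfolding h(3)[of t, symmetric] by (intro sum_mono)
  qed (intro continuous_intros h)+
  finally have sum_sq: "(\<Sum>i\<in>I. (norm (v i))\<^sup>2) \<le> (norm y)\<^sup>2"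
    by (simp add: K.fc_const rinner_self)
  have "norm (Z y) \<le> (\<Sum>i\<in>I. 2 * (sqrt (\<beta> i) * norm (v i)))"
    unfolding sum_v[symmetric] blinfun.sum_right by (intro sum_norm_le Z_v)
  then have "(norm (Z y))\<^sup>2 \<le> (2 * (\<Sum>i\<in>I. sqrt (\<beta> i) * norm (v i)))\<^sup>2"
    by (simp add: sum_distrib_left power_mono)
  also have "\<dots> \<le> 4 * ((\<Sum>i\<in>I. (sqrt (\<beta> i))\<^sup>2) * (\<Sum>i\<in>I. (norm (v i))\<^sup>2))"
    using Cauchy_Schwarz_ineq_sum[of "\<lambda>i. sqrt (\<beta> i)" "\<lambda>i. norm (v i)" I]
    by (simp add: power_mult_distrib)
  also have "(\<Sum>i\<in>I. (sqrt (\<beta> i))\<^sup>2) = (\<Sum>i\<in>I. \<beta> i)"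
    using \<beta>(1) by (intro sum.cong) auto
  also have "4 * ((\<Sum>i\<in>I. \<beta> i) * (\<Sum>i\<in>I. (norm (v i))\<^sup>2)) \<le> 4 * (e * (norm y)\<^sup>2)"
    using \<beta> sum_sq by (intro mult_left_mono mult_mono) (auto intro: sum_nonneg order_trans[OF sum_nonneg \<beta>(2)])
  finally show ?thesis by (simp add: Z_def)
qed

lemma preserved_hinge:
  assumes f: "preserved f" and strict: "strictly_convex_on {a..b} f" and c: "a < c" "c < b"
  shows "preserved (\<lambda>t. max (t - c) 0)"
proof -
  let ?u = "\<lambda>t. max (t - c) 0"
  have cont: "continuous_on {a..b} f" using f by (simp add: preserved_def)
  have u_cont: "continuous_on {a..b} ?u" by (intro continuous_intros)
  have bound: "(norm ((\<phi> (H.fc ?u) - K.fc ?u) y))\<^sup>2 \<le> 4 * e * (norm y)\<^sup>2" if "e > 0" for e y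
  proof -
    obtain h :: "nat \<Rightarrow> real \<Rightarrow> real" and I :: "nat set" and w A :: "nat \<Rightarrow> real \<Rightarrow> real"
      and \<beta> :: "nat \<Rightarrow> real" where I: "finite I"
      and h: "\<forall>i. continuous_on {a..b} (h i)" "\<forall>i t. 0 \<le> h i t" "\<forall>t. (\<Sum>i\<in>I. h i t) = 1"
      and w: "\<forall>i. w i = (\<lambda>t. max (t - c) 0) \<or> w i = (\<lambda>t. max (c - t) 0)"
      and A: "\<forall>i. \<exists>\<alpha> \<gamma> C. A i = (\<lambda>t. \<alpha> + \<gamma> * t + C * f t)"
        "\<forall>i\<in>I. \<forall>t\<in>{a..b}. (w i t)\<^sup>2 \<le> A i t"
        "\<forall>i\<in>I. \<forall>t\<in>{a..b}. h i t \<noteq> 0 \<longrightarrow> A i t \<le> \<beta> i"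
      and \<beta>: "\<forall>i\<in>I. 0 \<le> \<beta> i" "(\<Sum>i\<in>I. \<beta> i) \<le> e"
      by (rule hinge_partition_of_unity[OF cont strict c \<open>e > 0\<close>])
    show ?thesis
    proof (rule norm_defect_le[where I = I and h = h and w = w and A = A and \<beta> = \<beta>])
      show "continuous_on {a..b} (w i)" for i
        using w[rule_format, of i] by (auto intro!: continuous_intros)
      show "preserved (\<lambda>t. w i t - max (t - c) 0)" for i
      proof (cases "w i = ?u")
        case True
        then show ?thesis by (simp add: preserved_const)
      next
        case False
        then have "w i = (\<lambda>t. max (c - t) 0)" using w by blast
        then have eq: "(\<lambda>t. w i t - max (t - c) 0) = (\<lambda>t. c + (- 1) * t)"
          by (auto simp: fun_eq_iff max_def)
        show ?thesis
          unfolding eq by (intro preserved_add preserved_const preserved_scale preserved_id)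
      qed
      show "preserved (A i)" for i
      proof -
        obtain \<alpha> \<gamma> C where "A i = (\<lambda>t. \<alpha> + \<gamma> * t + C * f t)" using A(1) by blast
        then show ?thesis
          by (simp only: preserved_add preserved_scale preserved_const preserved_id f)
      qed
    qed (use I h A(2,3) \<beta> u_cont in auto)
  qed
  have "(\<phi> (H.fc ?u) - K.fc ?u) y = 0" for y
  proof -
    have "(norm ((\<phi> (H.fc ?u) - K.fc ?u) y))\<^sup>2 \<le> 0 + d" if "d > 0" for d
    proof -
      \<comment> \<open>The summand 1 covers \<open>y = 0\<close>.\<close>
      define e where "e = d / (4 * (norm y)\<^sup>2 + 1)"
      have pos: "4 * (norm y)\<^sup>2 + 1 > 0" by (simp add: add_nonneg_pos)
      have "e > 0" using that pos by (simp add: e_def)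
      have "4 * e * (norm y)\<^sup>2 \<le> e * (4 * (norm y)\<^sup>2 + 1)"
        using \<open>e > 0\<close> by (simp add: algebra_simps)
      also have "\<dots> = d" using pos by (simp add: e_def)
      finally show ?thesis using bound[OF \<open>e > 0\<close>, of y] by simp
    qed
    then have "(norm ((\<phi> (H.fc ?u) - K.fc ?u) y))\<^sup>2 \<le> 0"
      by (rule field_le_epsilon)
    then show ?thesis by simp
  qed
  then have "\<phi> (H.fc ?u) - K.fc ?u = 0"
    by (intro blinfun_eqI) simp
  then show ?thesis
    using u_cont by (simp add: preserved_def)
qed

text \<open>The shifted square \<open>(t - a)\<^sup>2\<close> has a nonnegative base, as
  \<open>square_hinge_sum\<close> requires. It lies between \<open>L\<close> and
  \<open>L + \<eta>\<close>, both preserved, so monotonicity on either side bounds the difference of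
  the forms by \<open>\<eta>\<close> times the square of \<open>norm y\<close>, and
  \<open>\<eta>\<close> tends to 0 with the mesh. An affine correction leads back to
  \<open>t * t\<close>.\<close>

lemma map_square_form_eq:
  assumes f: "preserved f" and strict: "strictly_convex_on {a..b} f" and "a \<le> b"
  shows "rinner y (\<phi> (H.fc (\<lambda>t. t * t)) y) = rinner y (K.fc (\<lambda>t. t * t) y)"
proof -
  let ?Q = "\<lambda>t. (t - a)\<^sup>2"
  define D where "D = \<bar>rinner y (\<phi> (H.fc ?Q) y) - rinner y (K.fc ?Q y)\<bar>"
  have Q_cont: "continuous_on {a..b} ?Q" by (intro continuous_intros)
  have D_le: "D \<le> (2 * (b - a)\<^sup>2 * (norm y)\<^sup>2) / real (Suc n)" for n
  proof (cases "a = b")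
    case True
    \<comment> \<open>A one-point interval has no interior hinges and would give mesh width 0, but
      \<open>?Q\<close> vanishes on it.\<close>
    have "H.fc ?Q = H.fc (\<lambda>t. 0)" "K.fc ?Q = K.fc (\<lambda>t. 0)"
      using True by (auto intro!: H.fc_cong K.fc_cong Q_cont)
    then have "D = 0" by (simp add: D_def H.fc_const K.fc_const map_zero)
    then show ?thesis by simp
  next
    case False
    then have "a < b" using \<open>a \<le> b\<close> by simp
    define d where "d = (b - a) / real (Suc n)"
    have "d > 0" and nd: "real (Suc n) * d = b - a"
      using \<open>a < b\<close> by (auto simp: d_def)
    define L where "L t = 2 * d * (\<Sum>k<n. max (t - (a + real (Suc k) * d)) 0)" for t
    define \<eta> where "\<eta> = 2 * d * (b - a)"
    have "preserved L"
      unfolding L_def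
    proof (intro preserved_scale preserved_sum)
      fix k assume "k \<in> {..<n}"
      \<comment> \<open>As \<open>k < n\<close>, the hinge point lies strictly inside the interval,
        which \<open>preserved_hinge\<close> requires.\<close>
      then have "real (Suc k) * d < real (Suc n) * d"
        using \<open>d > 0\<close> by (intro mult_strict_right_mono) auto
      moreover have "0 < real (Suc k) * d"
        using \<open>d > 0\<close> by simp
      ultimately show "preserved (\<lambda>t. max (t - (a + real (Suc k) * d)) 0)"
        unfolding nd by (intro preserved_hinge[OF f strict]) linarith+
    qed
    then have L': "preserved (\<lambda>t. L t + \<eta>)"
      by (intro preserved_add preserved_const)
    have L_cont: "continuous_on {a..b} L" and L'_cont: "continuous_on {a..b} (\<lambda>t. L t + \<eta>)"
      using \<open>preserved L\<close> L' by (simp_all add: preserved_def)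
    have bounds: "L t \<le> ?Q t" "?Q t \<le> L t + \<eta>" if "t \<in> {a..b}" for t
    proof -
      have "0 \<le> t - a" "t - a \<le> real (Suc n) * d" using that nd by auto
      note * = square_hinge_sum[OF \<open>d > 0\<close> this]
      have "d * (t - a) \<le> d * (b - a)" using that \<open>d > 0\<close> by (intro mult_left_mono) auto
      with * show "L t \<le> ?Q t" "?Q t \<le> L t + \<eta>"
        by (simp_all add: L_def \<eta>_def diff_diff_eq)
    qed
    have "K.fc (\<lambda>t. L t + \<eta>) = K.fc L + \<eta> *\<^sub>R id_blinfun"
      by (simp add: K.fc_add[OF L_cont] K.fc_const)
    then have upper: "rinner y (K.fc (\<lambda>t. L t + \<eta>) y) = rinner y (K.fc L y) + \<eta> * (norm y)\<^sup>2"
      by (simp add: plus_blinfun.rep_eq scaleR_blinfun.rep_eq rinner.add_right rinner.scaleR_right rinner_self)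
    have "rinner y (\<phi> (H.fc L) y) \<le> rinner y (\<phi> (H.fc ?Q) y)"
      "rinner y (\<phi> (H.fc ?Q) y) \<le> rinner y (\<phi> (H.fc (\<lambda>t. L t + \<eta>)) y)"
      by (intro map_fc_mono L_cont L'_cont Q_cont bounds; assumption)+
    moreover have "rinner y (K.fc L y) \<le> rinner y (K.fc ?Q y)"
      "rinner y (K.fc ?Q y) \<le> rinner y (K.fc (\<lambda>t. L t + \<eta>) y)"
      by (intro K.fc_mono L_cont L'_cont Q_cont bounds; assumption)+
    moreover have "\<phi> (H.fc L) = K.fc L" "\<phi> (H.fc (\<lambda>t. L t + \<eta>)) = K.fc (\<lambda>t. L t + \<eta>)"
      using \<open>preserved L\<close> L' by (simp_all add: preserved_def)
    ultimately have "D \<le> \<eta> * (norm y)\<^sup>2"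
      using upper by (simp add: D_def)
    also have "\<eta> = 2 * (b - a)\<^sup>2 / real (Suc n)"
      by (simp add: \<eta>_def d_def power2_eq_square)
    finally show ?thesis by simp
  qed
  have "(\<lambda>n. (2 * (b - a)\<^sup>2 * (norm y)\<^sup>2) / real (Suc n)) \<longlonglongrightarrow> 0"
    using LIMSEQ_Suc[OF lim_const_over_n] by blast
  then have "D \<le> 0"
    by (rule LIMSEQ_le_const) (use D_le in blast)
  then have Q_eq: "rinner y (\<phi> (H.fc ?Q) y) = rinner y (K.fc ?Q y)"
    by (simp add: D_def)
  let ?l = "\<lambda>t. 2 * a * t + - a\<^sup>2"
  have l: "preserved ?l"
    by (intro preserved_add preserved_scale preserved_const preserved_id)
  then have l_cont: "continuous_on {a..b} ?l" by (simp add: preserved_def)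
  have sq: "(\<lambda>t. t * t) = (\<lambda>t. ?Q t + ?l t)"
    by (auto simp: power2_eq_square algebra_simps)
  show ?thesis
    unfolding sq H.fc_add[OF Q_cont l_cont] K.fc_add[OF Q_cont l_cont]
    using l Q_eq by (simp add: map_add fc_in_bounded_ops Q_cont l_cont preserved_def
        plus_blinfun.rep_eq rinner.add_right)
qed

text \<open>Kadison's inequality for \<open>s H + H\<^sup>n\<close> has equal coefficients of \<open>s\<^sup>2\<close> on both sides, so its
  coefficients of \<open>s\<close> agree as well.\<close>

lemma preserved_power:
  assumes sq: "\<And>y. rinner y (\<phi> (H.fc (\<lambda>t. t * t)) y) = rinner y (K.fc (\<lambda>t. t * t) y)"
  shows "preserved (\<lambda>t. t ^ n)"
proof (induction n)
  case 0
  then show ?case by (simp add: preserved_const)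
next
  case (Suc n)
  have cont: "continuous_on {a..b} (\<lambda>t. t ^ m)" for m :: nat
    by (intro continuous_intros)
  have cont_id: "continuous_on {a..b} (\<lambda>t. t)" and cont2: "continuous_on {a..b} (\<lambda>t. t * t)"
    by (intro continuous_intros)+
  have "rinner y (\<phi> (H.fc (\<lambda>t. t ^ Suc n)) y) = rinner y (K.fc (\<lambda>t. t ^ Suc n) y)" for y
  proof -
    define p where "p = rinner y (\<phi> (H.fc (\<lambda>t. t ^ Suc n)) y)"
    define q where "q = rinner y (K.fc (\<lambda>t. t ^ Suc n) y)"
    define u where "u = rinner y (\<phi> (H.fc (\<lambda>t. t ^ (n + n))) y)"
    define v where "v = rinner y (K.fc (\<lambda>t. t ^ (n + n)) y)"
    have lin: "0 \<le> s * (2 * (p - q)) + (u - v)" for s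
    proof -
      let ?X = "\<lambda>t. s * t + t ^ n"
      let ?X2 = "\<lambda>t. (s\<^sup>2 * (t * t) + (2 * s) * t ^ Suc n) + t ^ (n + n)"
      have X: "preserved ?X"
        by (intro preserved_add preserved_scale preserved_id Suc.IH)
      then have X_cont: "continuous_on {a..b} ?X" by (simp add: preserved_def)
      have X2: "(\<lambda>t. ?X t * ?X t) = ?X2"
        by (auto simp: power2_eq_square power_add algebra_simps)
      have s2: "continuous_on {a..b} (\<lambda>t. s\<^sup>2 * (t * t))"
        and s1: "continuous_on {a..b} (\<lambda>t. (2 * s) * t ^ Suc n)"
        and s12: "continuous_on {a..b} (\<lambda>t. s\<^sup>2 * (t * t) + (2 * s) * t ^ Suc n)"
        by (intro continuous_intros)+
      have H_X2: "H.fc ?X2 = (s\<^sup>2 *\<^sub>R H.fc (\<lambda>t. t * t) + (2 * s) *\<^sub>R H.fc (\<lambda>t. t ^ Suc n)) + H.fc (\<lambda>t. t ^ (n + n))"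
        by (simp only: H.fc_add[OF s12 cont] H.fc_add[OF s2 s1] H.fc_scaleR[OF cont2] H.fc_scaleR[OF cont])
      have K_X2: "K.fc ?X2 = (s\<^sup>2 *\<^sub>R K.fc (\<lambda>t. t * t) + (2 * s) *\<^sub>R K.fc (\<lambda>t. t ^ Suc n)) + K.fc (\<lambda>t. t ^ (n + n))"
        by (simp only: K.fc_add[OF s12 cont] K.fc_add[OF s2 s1] K.fc_scaleR[OF cont2] K.fc_scaleR[OF cont])
      have ops: "H.fc (\<lambda>t. t * t) \<in> bounded_ops" "H.fc (\<lambda>t. t ^ m) \<in> bounded_ops" for m
        using cont cont2 by (auto intro: fc_in_bounded_ops)
      \<comment> \<open>The induction hypothesis makes \<open>?X\<close> preserved, so Kadison's
        inequality compares the images of the same square; the unknown power \<open>Suc n\<close>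
        sits in its cross term.\<close>
      have "rinner y (K.fc ?X2 y) = (norm (K.fc ?X y))\<^sup>2"
        unfolding K.norm_fc_square[OF X_cont] power2_eq_square[of "?X _"] X2 ..
      also have "\<dots> = (norm (\<phi> (H.fc ?X) y))\<^sup>2"
        using X by (simp add: preserved_def)
      also have "\<dots> \<le> rinner y (\<phi> (H.fc ?X o\<^sub>L H.fc ?X) y)"
        by (intro kadison_inequality H.selfadjoint_fc X_cont)
      also have "H.fc ?X o\<^sub>L H.fc ?X = H.fc ?X2"
        unfolding X2[symmetric] by (rule H.fc_mult[OF X_cont X_cont, symmetric])
      finally show ?thesis
        using sq[of y] unfolding H_X2 K_X2 p_def q_def u_def v_def
        by (simp only: map_add map_scaleR ops bounded_ops_add bounded_ops_scaleR plus_blinfun.rep_eq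
            scaleR_blinfun.rep_eq rinner.add_right rinner.scaleR_right)
           (simp add: algebra_simps)
    qed
    have "p = q"
    proof (rule ccontr)
      assume "p \<noteq> q"
      \<comment> \<open>With this \<open>s\<close> the right-hand side of \<open>lin\<close> would
        be \<open>-1\<close>.\<close>
      then have "(- (u - v + 1) / (2 * (p - q))) * (2 * (p - q)) = - (u - v + 1)" by simp
      then show False
        using lin[of "- (u - v + 1) / (2 * (p - q))"] by linarith
    qed
    then show ?thesis by (simp only: p_def q_def)
  qed
  then have "\<phi> (H.fc (\<lambda>t. t ^ Suc n)) = K.fc (\<lambda>t. t ^ Suc n)"
    by (intro selfadjoint_op_eqI selfadjoint_map H.selfadjoint_fc K.selfadjoint_fc cont)
  then show ?case
    using cont by (simp only: preserved_def)
qed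

text \<open>\<open>preserved\<close> concerns real functions, whereas \<open>p\<close> has complex
  coefficients; going through the powers leaves these to the complex linearity of
  \<open>\<phi>\<close>.\<close>

lemma map_poly_op:
  assumes "\<And>n. preserved (\<lambda>t. t ^ n)"
  shows "\<phi> (poly_op p H) = poly_op p (\<phi> H)"
proof -
  have "\<phi> (((o\<^sub>L) H ^^ n) id_blinfun) = ((o\<^sub>L) (\<phi> H) ^^ n) id_blinfun" for n
  proof -
    have "H.fc (\<lambda>t. t ^ n) = ((o\<^sub>L) H ^^ n) id_blinfun"
      by (induction n) (simp_all add: H.fc_const H.fc_mult H.fc_id continuous_on_power)
    moreover have "K.fc (\<lambda>t. t ^ n) = ((o\<^sub>L) (\<phi> H) ^^ n) id_blinfun"
      by (induction n) (simp_all add: K.fc_const K.fc_mult K.fc_id continuous_on_power)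
    ultimately show ?thesis
      using assms[of n] by (simp add: preserved_def)
  qed
  then show ?thesis
    by (simp add: poly_op_def map_sum map_scaleC bounded_ops_funpow H.T_in_bounded_ops)
qed

end

theorem corollary2p8:
  fixes f :: "real \<Rightarrow> real" and a b :: real
    and \<phi> :: "('h :: chilbert_space \<Rightarrow>\<^sub>L 'h) \<Rightarrow> ('k :: chilbert_space \<Rightarrow>\<^sub>L 'k)"
    and H :: "'h \<Rightarrow>\<^sub>L 'h"
  assumes "a \<le> b"
    and "continuous_on {a..b} f"
    and "strictly_convex_on {a..b} f"
    and "completely_positive \<phi>"
    and "unital_map \<phi>"
    and "selfadjoint_op H"
    and "op_spectrum H \<subseteq> complex_of_real ` {a..b}"
    and "\<phi> (cfc (\<lambda>t. complex_of_real (f t)) H) = cfc (\<lambda>t. complex_of_real (f t)) (\<phi> H)"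
  shows "multiplicative_on (poly_algebra H) \<phi>"
proof -
  interpret ucp_calculus \<phi> H a b
    using assms by unfold_locales
  have "preserved f"
    using assms(2,8) by (simp add: preserved_def H.fc_def K.fc_def)
  then have "\<phi> (poly_op p H) = poly_op p (\<phi> H)" for p
    by (intro map_poly_op preserved_power map_square_form_eq[OF _ assms(3,1)])
  \<comment> \<open>Evaluation of polynomials is multiplicative both at \<open>H\<close> and at
    \<open>\<phi> H\<close>, and \<open>\<phi>\<close> carries the first evaluation to the
    second.\<close>
  then show ?thesis
    by (auto simp: multiplicative_on_def poly_algebra_def
        simp flip: poly_op_mult[OF H.T_in_bounded_ops] poly_op_mult[OF K.T_in_bounded_ops])
qed

end
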